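(* Let $G=\mathbb{R}^n$ be a stratified nilpotent Lie group with Lie algebra $\mathfrak g$, identified with $\mathbb{R}^n$ via exponential coordinates of the second type induced by an adapted basis $X_1,\dots,X_n$ of $\mathfrak g$. Let $\{X_j\}_{j\le n}$ be an extension of it to an adapted basis of the Tanaka prolongation $\mathrm{Prol}(\mathfrak g)$, with structure constants $c_{ij}^k$, and let $P_j^v$ ($j\le n$, $v\in\mathbb{R}^n$) be the associated extremal polynomials. Then for any $v\in\mathbb{R}^n$, any $i=1,\dots,n$, and any $j\in\mathbb{Z}$ with $j\le n$, there holds $$X_i P_j^v(x)=\sum_{k\le n} c_{ij}^k\, P_k^v(x),\qquad x\in\mathbb{R}^n.$$
   Context: Stratified group. $G$ is a (connected, simply connected) nilpotent Lie group of dimension $n$ whose real Lie algebra of left-invariant vector fields is stratified: $\mathfrak g=\mathfrak g_1\oplus\cdots\oplus\mathfrak g_s$, $\mathfrak g_i=[\mathfrak g_{i-1},\mathfrak g_1]$ for $i=2,\dots,s$, $\mathfrak g_i=\{0\}$ for $i>s$; $s$ is the step and $r=\dim\mathfrak g_1$ the rank. Tanaka prolongation. $\mathfrak g_0$ is the space of linear maps $\phi:\mathfrak g\to\mathfrak g$ with $\phi(\mathfrak g_i)\subset\mathfrak g_i$ for $i=1,\dots,s$ and $\phi([X,Y])=[\phi(X),Y]+[X,\phi(Y)]$ for all $X,Y\in\mathfrak g$. Set $[\phi,X]=-[X,\phi]=\phi(X)$ for $\phi\in\mathfrak g_0$, $X\in\mathfrak g$. Inductively for $k\ge1$, when $\mathfrak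 g_{1-k},\dots,\mathfrak g_s$ and the brackets $[\phi,X]=\phi(X)$ with $X\in\mathfrak g$ are already defined, $\mathfrak g_{-k}$ is the space of linear maps $\phi:\mathfrak g\to\mathfrak g_{1-k}\oplus\cdots\oplus\mathfrak g_{s-k}$ with $\phi(\mathfrak g_i)\subset\mathfrak g_{i-k}$ for $i=1,\dots,s$ and $\phi([X,Y])=[\phi(X),Y]+[X,\phi(Y)]$ for all $X,Y\in\mathfrak g$; again $[\phi,X]=-[X,\phi]=\phi(X)$ for $X\in\mathfrak g$. For $\phi,\psi$ of degree $\le 0$ the bracket is defined inductively by $[\phi,\psi](X)=[[\phi,X],\psi]+[\phi,[\psi,X]]$, $X\in\mathfrak g$. Then $\mathrm{Prol}(\mathfrak g)=\bigoplus_{k\le s}\mathfrak g_k$ is a graded Lie algebra ($[\mathfrak g_i,\mathfrak g_j]\subset\mathfrak g_{i+j}$) with finite-dimensional strata, possibly infinite dimensional. Basis and degrees. $X_1,\dots,X_n$ is a basis of $\mathfrak g$ adapted to the stratification, extended to a basis $\{X_j\}_{j\le n}$ of $\mathrm{Prol}(\mathfrak g)$ indexed by integers $j\le n$ (if $\mathrm{Prol}(\mathfrak g)$ is finite dimensional, by $m\le j\le n$ for some $m\in\mathbb{Z}$; the notation $j\le n$ is still used and always refers to indices in the range). Each $X_j$ lies in some stratum $\mathfrak g_k$; its degree is $d(j)=k$. The basis is adapted: $i<j$ implies $d(i)\le d(j)$. Structure constants: $[X_i,X_j]=\sum_{k\le n}c_{ij}^kX_k$ (a finite sum). Coordinates.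 $G$ is identified with $\mathbb{R}^n$ by $x=(x_1,\dots,x_n)\leftrightarrow \exp(x_nX_n)\cdot\ldots\cdot\exp(x_1X_1)$, and $X_1,\dots,X_n$ are viewed as left-invariant vector fields on $\mathbb{R}^n$, acting as derivations on functions. Generalized structure constants. For $\alpha\in\mathbb{N}^n=\{0,1,2,\dots\}^n$ and $i\le n$, $[X_i,X_\alpha]$ denotes the left-nested iterated bracket $[\cdots[[X_i,X_1],X_1],\dots,X_n]$ in which, starting from $X_i$, one brackets on the right $\alpha_1$ times with $X_1$, then $\alpha_2$ times with $X_2$, ..., finally $\alpha_n$ times with $X_n$; $[X_i,X_0]=X_i$. The constants $c_{i\alpha}^k$ are defined by $[X_i,X_\alpha]=\sum_{k\le n}c_{i\alpha}^kX_k$. Extremal polynomials. For $v=(v_1,\dots,v_n)\in\mathbb{R}^n$, with the convention $v_k=0$ for $k\le0$, and for $i\le n$, $$P_i^v(x)=\sum_{\alpha\in\mathbb{N}^n}\frac{(-1)^{|\alpha|}}{\alpha!}\Big(\sum_{k\le n}c_{i\alpha}^kv_k\Big)x^\alpha,\qquad x\in\mathbb{R}^n,$$ where $|\alpha|=\alpha_1+\cdots+\alpha_n$, $\alpha!=\alpha_1!\cdots\alpha_n!$ (only finitely many terms are nonzero). *)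

theory Defs
  imports
    "HOL-Analysis.Analysis"
    "HOL-Library.Function_Algebras"
    "HOL-Library.Groups_Big_Fun"
begin

section \<open>Lie groups on Euclidean space and their left-invariant vector fields\<close>

instantiation "fun" :: (type, real_vector) real_vector
begin

definition scaleR_fun :: "real \<Rightarrow> ('a \<Rightarrow> 'b) \<Rightarrow> 'a \<Rightarrow> 'b" where
  "scaleR_fun c f = (\<lambda>x. c *\<^sub>R f x)"

instance
  by standard (simp_all add: scaleR_fun_def plus_fun_def scaleR_add_right scaleR_add_left)

end

lemma scaleR_fun_apply [simp]: "(c *\<^sub>R f) x = c *\<^sub>R f x"
  by (simp add: scaleR_fun_def)

text \<open>On a finite-dimensional domain, \<open>C_diff k f\<close> says that \<open>f\<close> is of class $C^k$ everywhere.\<close>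

primrec C_diff :: "nat \<Rightarrow> ('a::real_normed_vector \<Rightarrow> 'b::real_normed_vector) \<Rightarrow> bool" where
  "C_diff 0 f \<longleftrightarrow> continuous_on UNIV f"
| "C_diff (Suc k) f \<longleftrightarrow> (\<forall>x. f differentiable (at x)) \<and>
     (\<forall>w. C_diff k (\<lambda>x. frechet_derivative f (at x) w))"

definition smooth_map :: "('a::real_normed_vector \<Rightarrow> 'b::real_normed_vector) \<Rightarrow> bool" where
  "smooth_map f \<longleftrightarrow> (\<forall>k. C_diff k f)"

type_synonym 'n vfield = "real ^ 'n \<Rightarrow> real ^ 'n"

text \<open>The group \<open>G\<close> has \<open>real ^ 'n\<close> as its underlying manifold, so that it is automatically
  connected and simply connected.\<close>

definition lie_group_on ::
    "(real ^ 'n \<Rightarrow> real ^ 'n \<Rightarrow> real ^ 'n) \<Rightarrow> real ^ 'n \<Rightarrow> (real ^ 'n \<Rightarrow> real ^ 'n) \<Rightarrow> bool" where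
  "lie_group_on mul e iv \<longleftrightarrow>
     Groups.group mul e iv \<and> smooth_map (\<lambda>(p, q). mul p q) \<and> smooth_map iv"

definition vf_apply :: "'n::finite vfield \<Rightarrow> (real ^ 'n \<Rightarrow> real) \<Rightarrow> real ^ 'n \<Rightarrow> real" where
  "vf_apply X f x = frechet_derivative f (at x) (X x)"

text \<open>Coordinate expression of the commutator: as derivations, \<open>[X, Y] f = X (Y f) - Y (X f)\<close>.\<close>

definition vf_bracket :: "'n::finite vfield \<Rightarrow> 'n vfield \<Rightarrow> 'n vfield" where
  "vf_bracket X Y =
     (\<lambda>x. frechet_derivative Y (at x) (X x) - frechet_derivative X (at x) (Y x))"

definition left_inv_fields :: "(real ^ 'n \<Rightarrow> real ^ 'n \<Rightarrow> real ^ 'n) \<Rightarrow> 'n::finite vfield set" where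
  "left_inv_fields mul =
     {X. smooth_map X \<and> (\<forall>p q. X (mul p q) = frechet_derivative (mul p) (at q) (X q))}"

text \<open>\<open>lie_exp e X = \<gamma> 1\<close>, where \<open>\<gamma>\<close> is the integral curve of \<open>X\<close> starting at the identity \<open>e\<close>.\<close>

definition lie_exp :: "real ^ 'n \<Rightarrow> 'n::finite vfield \<Rightarrow> real ^ 'n" where
  "lie_exp e X = (THE y. \<exists>\<gamma>. \<gamma> 0 = e \<and>
     (\<forall>t. (\<gamma> has_vector_derivative X (\<gamma> t)) (at t)) \<and> \<gamma> 1 = y)"

text \<open>Exponential coordinates of the second type; \<open>coord l\<close> is the index type's name for the
  \<open>l\<close>-th coordinate, \<open>1 \<le> l \<le> n\<close>.  The product is
  \<open>exp (x\<^sub>n X\<^sub>n) \<cdot> \<dots> \<cdot> exp (x\<^sub>1 X\<^sub>1)\<close>.\<close>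

definition second_type_coordinates ::
    "(real ^ 'n \<Rightarrow> real ^ 'n \<Rightarrow> real ^ 'n) \<Rightarrow> real ^ 'n \<Rightarrow> (int \<Rightarrow> 'n) \<Rightarrow>
     (int \<Rightarrow> 'n::finite vfield) \<Rightarrow> bool" where
  "second_type_coordinates mul e coord X \<longleftrightarrow>
     (\<forall>x. x = foldr (\<lambda>l. mul (lie_exp e ((x $ coord l) *\<^sub>R X l))) (rev [1..int CARD('n)]) e)"


section \<open>Stratified Lie algebras\<close>

text \<open>A Lie algebra is given by its carrier \<open>g\<close> and its bracket \<open>b\<close>.  Layers are indexed by all
  integers, with \<open>V k = {0}\<close> for \<open>k\<close> outside \<open>{1..s}\<close> (so \<open>V k\<close> is not the \<open>k\<close>-th stratum of
  the prolongation for \<open>k \<le> 0\<close>).  As usual, \<open>[g\<^sub>s, g\<^sub>1] = 0\<close> is included.\<close>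

definition stratification ::
    "'a::real_vector set \<Rightarrow> ('a \<Rightarrow> 'a \<Rightarrow> 'a) \<Rightarrow> (int \<Rightarrow> 'a set) \<Rightarrow> int \<Rightarrow> bool" where
  "stratification g b V s \<longleftrightarrow>
     1 \<le> s \<and> V s \<noteq> {0} \<and>
     (\<forall>k. subspace (V k)) \<and>
     (\<forall>k. k < 1 \<or> s < k \<longrightarrow> V k = {0}) \<and>
     (\<forall>k\<ge>2. V k = span {b X Y | X Y. X \<in> V (k - 1) \<and> Y \<in> V 1}) \<and>
     span (\<Union>k\<in>{1..s}. V k) = g \<and>
     (\<forall>f. (\<forall>k\<in>{1..s}. f k \<in> V k) \<and> (\<Sum>k\<in>{1..s}. f k) = 0 \<longrightarrow> (\<forall>k\<in>{1..s}. f k = 0))"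

text \<open>Here \<open>S\<close> is the family of strata, \<open>W\<close> the graded space, \<open>I\<close> the index set, and \<open>d\<close> the
  degree.\<close>

definition adapted_basis ::
    "(int \<Rightarrow> 'a::real_vector set) \<Rightarrow> 'a set \<Rightarrow> int set \<Rightarrow> (int \<Rightarrow> 'a) \<Rightarrow> (int \<Rightarrow> int) \<Rightarrow> bool" where
  "adapted_basis S W I B d \<longleftrightarrow>
     inj_on B I \<and> independent (B ` I) \<and> span (B ` I) = W \<and>
     (\<forall>i\<in>I. B i \<in> S (d i)) \<and> (\<forall>i\<in>I. \<forall>j\<in>I. i < j \<longrightarrow> d i \<le> d j)"


section \<open>The Tanaka prolongation\<close>

text \<open>An element of the prolongation is a sum \<open>X + \<phi>\<close> with \<open>X\<close> in the Lie algebra \<open>g\<close> and \<open>\<phi>\<close> a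
  sum of elements of degree \<open>\<le> 0\<close>, that is, a linear map from \<open>g\<close> to the prolongation.  It is
  encoded as \<open>Tk X \<phi>\<close>.  The type below also contains elements outside the prolongation; the
  latter is carved out by \<open>prol_stratum\<close> and \<open>prol\<close>.\<close>

codatatype 'a tk = Tk (gpart: 'a) (mpart: "'a \<Rightarrow> 'a tk")

instantiation tk :: (real_vector) real_vector
begin

primcorec zero_tk :: "'a tk" where
  "gpart zero_tk = 0"
| "mpart zero_tk = (\<lambda>_. zero_tk)"

primcorec plus_tk :: "'a tk \<Rightarrow> 'a tk \<Rightarrow> 'a tk" where
  "gpart (plus_tk u v) = gpart u + gpart v"
| "mpart (plus_tk u v) = (\<lambda>Z. plus_tk (mpart u Z) (mpart v Z))"

primcorec uminus_tk :: "'a tk \<Rightarrow> 'a tk" where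
  "gpart (uminus_tk u) = - gpart u"
| "mpart (uminus_tk u) = (\<lambda>Z. uminus_tk (mpart u Z))"

primcorec minus_tk :: "'a tk \<Rightarrow> 'a tk \<Rightarrow> 'a tk" where
  "gpart (minus_tk u v) = gpart u - gpart v"
| "mpart (minus_tk u v) = (\<lambda>Z. minus_tk (mpart u Z) (mpart v Z))"

primcorec scaleR_tk :: "real \<Rightarrow> 'a tk \<Rightarrow> 'a tk" where
  "gpart (scaleR_tk c u) = c *\<^sub>R gpart u"
| "mpart (scaleR_tk c u) = (\<lambda>Z. scaleR_tk c (mpart u Z))"

instance
proof
  fix u v w :: "'a tk" and a c :: real
  show "u + v + w = u + (v + w)"
    by (coinduction arbitrary: u v w) (auto simp: rel_fun_def add.assoc)
  show "u + v = v + u"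
    by (coinduction arbitrary: u v) (auto simp: rel_fun_def add.commute)
  show "0 + u = u"
    by (coinduction arbitrary: u) (auto simp: rel_fun_def)
  show "- u + u = 0"
    by (coinduction arbitrary: u) (auto simp: rel_fun_def)
  show "u - v = u + - v"
    by (coinduction arbitrary: u v) (auto simp: rel_fun_def)
  show "a *\<^sub>R (u + v) = a *\<^sub>R u + a *\<^sub>R v"
    by (coinduction arbitrary: u v) (auto simp: rel_fun_def scaleR_add_right)
  show "(a + c) *\<^sub>R u = a *\<^sub>R u + c *\<^sub>R u"
    by (coinduction arbitrary: u) (auto simp: rel_fun_def scaleR_add_left)
  show "a *\<^sub>R c *\<^sub>R u = (a * c) *\<^sub>R u"
    by (coinduction arbitrary: u) (auto simp: rel_fun_def)
  show "1 *\<^sub>R u = u"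
    by (coinduction arbitrary: u) (auto simp: rel_fun_def)
qed

end

definition emb :: "'a::real_vector \<Rightarrow> 'a tk" where
  "emb X = Tk X (\<lambda>_. 0)"

text \<open>The bracket is the bilinear extension of \<open>[X, Y] = b X Y\<close>, \<open>[\<phi>, X] = - [X, \<phi>] = \<phi> X\<close> and
  \<open>[\<phi>, \<psi>] Z = [\<phi> Z, \<psi>] + [\<phi>, \<psi> Z]\<close>, as stated in \<open>prol_bracket_Tk\<close> below.  To obtain it by
  primitive recursion, an element \<open>u\<close> is described by the family of the \<open>g\<close>-components of all
  \<open>u Z\<^sub>1 \<dots> Z\<^sub>m\<close>.\<close>

primrec tk_at :: "'a list \<Rightarrow> 'a tk \<Rightarrow> 'a" where
  "tk_at [] u = gpart u"
| "tk_at (Z # zs) u = tk_at zs (mpart u Z)"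

primcorec tk_of :: "('a list \<Rightarrow> 'a) \<Rightarrow> 'a tk" where
  "gpart (tk_of h) = h []"
| "mpart (tk_of h) = (\<lambda>Z. tk_of (\<lambda>zs. h (Z # zs)))"

primrec bracket_at ::
    "('a::real_vector \<Rightarrow> 'a \<Rightarrow> 'a) \<Rightarrow> 'a list \<Rightarrow> 'a tk \<Rightarrow> 'a tk \<Rightarrow> 'a" where
  "bracket_at b [] u v =
     b (gpart u) (gpart v) + gpart (mpart u (gpart v)) - gpart (mpart v (gpart u))"
| "bracket_at b (Z # zs) u v =
     tk_at (Z # zs) (mpart u (gpart v)) - tk_at (Z # zs) (mpart v (gpart u)) +
     (bracket_at b zs (mpart u Z) (Tk 0 (mpart v)) + bracket_at b zs (Tk 0 (mpart u)) (mpart v Z))"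

definition prol_bracket ::
    "('a::real_vector \<Rightarrow> 'a \<Rightarrow> 'a) \<Rightarrow> 'a tk \<Rightarrow> 'a tk \<Rightarrow> 'a tk" where
  "prol_bracket b u v = tk_of (\<lambda>zs. bracket_at b zs u v)"

lemma tk_at_eqI:
  assumes "\<And>zs. tk_at zs u = tk_at zs v"
  shows "u = v"
proof -
  have "\<forall>zs. tk_at zs u = tk_at zs v"
    using assms by blast
  then show ?thesis
  proof (coinduction arbitrary: u v)
    case Eq_tk
    have "gpart u = gpart v"
      using Eq_tk[rule_format, of "[]"] by simp
    moreover have "tk_at zs (mpart u Z) = tk_at zs (mpart v Z)" for Z zs
      using Eq_tk[rule_format, of "Z # zs"] by simp
    ultimately show ?case
      by (auto simp: rel_fun_def)
  qed
qed

lemma tk_at_tk_of [simp]: "tk_at zs (tk_of h) = h zs"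
  by (induction zs arbitrary: h) auto

lemma tk_at_zero [simp]: "tk_at zs 0 = 0"
  by (induction zs) auto

lemma tk_at_add [simp]: "tk_at zs (u + v) = tk_at zs u + tk_at zs v"
  by (induction zs arbitrary: u v) auto

lemma tk_at_diff [simp]: "tk_at zs (u - v) = tk_at zs u - tk_at zs v"
  by (induction zs arbitrary: u v) auto

lemma prol_bracket_Tk:
  "prol_bracket b (Tk X \<phi>) (Tk Y \<psi>) =
     emb (b X Y) + \<phi> Y - \<psi> X +
     Tk 0 (\<lambda>Z. prol_bracket b (\<phi> Z) (Tk 0 \<psi>) + prol_bracket b (Tk 0 \<phi>) (\<psi> Z))"
proof (rule tk_at_eqI)
  fix zs
  show "tk_at zs (prol_bracket b (Tk X \<phi>) (Tk Y \<psi>)) = tk_at zs (emb (b X Y) + \<phi> Y - \<psi> X +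
      Tk 0 (\<lambda>Z. prol_bracket b (\<phi> Z) (Tk 0 \<psi>) + prol_bracket b (Tk 0 \<phi>) (\<psi> Z)))"
    by (cases zs) (auto simp: prol_bracket_def emb_def)
qed

text \<open>Since \<open>g\<close> is a subspace of the ambient type, maps on \<open>g\<close> are extended by zero outside
  \<open>g\<close>.\<close>

definition linear_map_on ::
    "'a::real_vector set \<Rightarrow> ('a \<Rightarrow> 'b::real_vector) \<Rightarrow> bool" where
  "linear_map_on g \<phi> \<longleftrightarrow>
     (\<forall>X\<in>g. \<forall>Y\<in>g. \<phi> (X + Y) = \<phi> X + \<phi> Y) \<and> (\<forall>c. \<forall>X\<in>g. \<phi> (c *\<^sub>R X) = c *\<^sub>R \<phi> X) \<and>
     (\<forall>X. X \<notin> g \<longrightarrow> \<phi> X = 0)"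

function prol_stratum ::
    "'a::real_vector set \<Rightarrow> ('a \<Rightarrow> 'a \<Rightarrow> 'a) \<Rightarrow> (int \<Rightarrow> 'a set) \<Rightarrow> int \<Rightarrow> int \<Rightarrow> 'a tk set" where
  "prol_stratum g b V s k =
     (if 1 \<le> k then emb ` V k
      else {Tk 0 \<phi> | \<phi>. linear_map_on g \<phi> \<and>
        (\<forall>i\<in>{1..s}. \<forall>X\<in>V i. \<phi> X \<in> prol_stratum g b V s (i + k)) \<and>
        (\<forall>X\<in>g. \<forall>Y\<in>g. \<phi> (b X Y) =
           prol_bracket b (\<phi> X) (emb Y) + prol_bracket b (emb X) (\<phi> Y))})"
  by pat_completeness auto
termination
  by (relation "Wellfounded.measure (\<lambda>(g, b, V, s, k). nat (1 - k))") auto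

declare prol_stratum.simps [simp del]

definition prol ::
    "'a::real_vector set \<Rightarrow> ('a \<Rightarrow> 'a \<Rightarrow> 'a) \<Rightarrow> (int \<Rightarrow> 'a set) \<Rightarrow> int \<Rightarrow> 'a tk set" where
  "prol g b V s = span (\<Union>k\<in>{..s}. prol_stratum g b V s k)"


section \<open>Structure constants and extremal polynomials\<close>

text \<open>The basis of the prolongation is \<open>E j\<close>, \<open>j \<in> J\<close>, where \<open>J\<close> is a set of integers with
  largest element \<open>n\<close>.  All families of numbers indexed by \<open>J\<close> vanish outside \<open>J\<close>, and
  \<^const>\<open>Sum_any\<close> is the sum of a finitely supported family.\<close>

definition tk_coeff :: "int set \<Rightarrow> (int \<Rightarrow> 'a::real_vector tk) \<Rightarrow> 'a tk \<Rightarrow> int \<Rightarrow> real" where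
  "tk_coeff J E u k = (if k \<in> J then representation (E ` J) u (E k) else 0)"

definition struct_const ::
    "int set \<Rightarrow> (int \<Rightarrow> 'n::finite vfield tk) \<Rightarrow> int \<Rightarrow> int \<Rightarrow> int \<Rightarrow> real" where
  "struct_const J E i j k = tk_coeff J E (prol_bracket vf_bracket (E i) (E j)) k"

definition iter_bracket ::
    "(int \<Rightarrow> 'n) \<Rightarrow> (int \<Rightarrow> 'n::finite vfield tk) \<Rightarrow> int \<Rightarrow> ('n \<Rightarrow> nat) \<Rightarrow> 'n vfield tk" where
  "iter_bracket coord E i \<alpha> =
     fold (\<lambda>l. (\<lambda>w. prol_bracket vf_bracket w (E l)) ^^ \<alpha> (coord l)) [1..int CARD('n)] (E i)"

definition gen_struct_const ::
    "(int \<Rightarrow> 'n) \<Rightarrow> int set \<Rightarrow> (int \<Rightarrow> 'n::finite vfield tk) \<Rightarrow> int \<Rightarrow> ('n \<Rightarrow> nat) \<Rightarrow> int \<Rightarrow> real"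
  where
  "gen_struct_const coord J E i \<alpha> k = tk_coeff J E (iter_bracket coord E i \<alpha>) k"

definition extend_vec :: "(int \<Rightarrow> 'n) \<Rightarrow> real ^ 'n::finite \<Rightarrow> int \<Rightarrow> real" where
  "extend_vec coord v k = (if 1 \<le> k \<and> k \<le> int CARD('n) then v $ coord k else 0)"

definition extremal_poly ::
    "(int \<Rightarrow> 'n) \<Rightarrow> int set \<Rightarrow> (int \<Rightarrow> 'n::finite vfield tk) \<Rightarrow> real ^ 'n \<Rightarrow> int \<Rightarrow> real ^ 'n \<Rightarrow> real"
  where
  "extremal_poly coord J E v i x =
     Sum_any (\<lambda>\<alpha> :: 'n \<Rightarrow> nat.
       (- 1) ^ (\<Sum>a\<in>UNIV. \<alpha> a) / (\<Prod>a\<in>UNIV. fact (\<alpha> a)) *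
       Sum_any (\<lambda>k. gen_struct_const coord J E i \<alpha> k * extend_vec coord v k) *
       (\<Prod>a\<in>UNIV. (x $ a) ^ \<alpha> a))"

end

theory Submission
  imports Defs
begin

text \<open>
  For \<open>u\<close> in the prolongation, let \<open>P\<^sub>u(x) = \<lambda>(e^{x\<^sub>n ad X\<^sub>n} \<cdots> e^{x\<^sub>1 ad X\<^sub>1} u)\<close>, where \<open>\<lambda>\<close> is the linear functional
  with \<open>\<lambda>(X\<^sub>k) = v\<^sub>k\<close>; expanding the exponentials, which are finite sums since \<open>ad X\<^sub>l\<close> raises
  degrees, identifies \<open>P\<^sub>j\<^sup>v\<close> with \<open>P\<^sub>u\<close> for \<open>u = X\<^sub>j\<close>.  Since \<open>e^{ad X}\<close> is an automorphism,
  \<open>\<partial>\<^sub>l P\<^sub>u(x) = P\<^bsub>[Z\<^sub>l, u]\<^esub>(x)\<close> with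
  \<open>Z\<^sub>l = e^{-x\<^sub>1 ad X\<^sub>1} \<cdots> e^{-x\<^sub>l\<^sub>-\<^sub>1 ad X\<^sub>l\<^sub>-\<^sub>1} X\<^sub>l\<close>.  On the other hand, moving the \<open>l\<close>-th factor of
  \<open>x = exp(x\<^sub>n X\<^sub>n) \<cdots> exp(x\<^sub>1 X\<^sub>1)\<close> moves \<open>x\<close> with velocity \<open>Z\<^sub>l(x)\<close>, because right translation by
  \<open>exp(t X)\<close> acts on left-invariant fields by \<open>e^{-t ad X}\<close>; thus the \<open>l\<close>-th coordinate vector is
  \<open>Z\<^sub>l(x)\<close>.  Writing the left-invariant field \<open>X\<^sub>i\<close> as a combination of the \<open>Z\<^sub>l\<close> that agrees with it at \<open>x\<close>
  gives \<open>X\<^sub>i P\<^sub>u = P\<^bsub>[X\<^sub>i, u]\<^esub>\<close>, and \<open>P\<^sub>u\<close> is linear in \<open>u\<close>.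
\<close>

section \<open>Smooth maps and the bracket of vector fields\<close>

text \<open>Write \<open>F h u\<close> as \<open>F h a\<close> plus the integral of
  \<open>G h\<close> over \<open>{a..u}\<close>, differentiate in \<open>h\<close> under the
  integral sign, then in \<open>u\<close> by the fundamental theorem of calculus.\<close>

lemma mixed_vector_derivative:
  fixes F :: "real \<Rightarrow> real \<Rightarrow> 'b::banach"
  assumes Ft: "\<And>h t. (F h has_vector_derivative G h t) (at t)"
    and Gh: "\<And>h t. ((\<lambda>h. G h t) has_vector_derivative K h t) (at h)"
    and Fh: "\<And>h t. ((\<lambda>h. F h t) has_vector_derivative W h t) (at h)"
    and cont: "continuous_on UNIV (\<lambda>(h, t). K h t)"
  shows "(W h has_vector_derivative K h t) (at t)"
proof -
  \<comment> \<open>Any base point strictly left of \<open>t\<close> serves: \<open>t\<close> is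
    then interior to \<open>{a..t+1}\<close> and derivatives within the interval are derivatives at
    \<open>t\<close>.\<close>
  define a where "a = t - 1"
  have ftc: "(G h has_integral F h u - F h a) {a..u}" if "a \<le> u" for h u
    by (rule fundamental_theorem_of_calculus[OF that has_vector_derivative_at_within[OF Ft]])
  have W_eq: "W h u = W h a + integral {a..u} (K h)" if "a \<le> u" for u
  proof -
    have "((\<lambda>h. integral (cbox a u) (G h)) has_vector_derivative integral (cbox a u) (K h)) (at h within UNIV)"
      using has_integral_integrable[OF ftc[OF that]]
      by (intro leibniz_rule_vector_derivative Gh continuous_on_subset[OF cont]) auto
    then have "((\<lambda>h. F h a + integral {a..u} (G h)) has_vector_derivative W h a + integral {a..u} (K h)) (at h)"
      by (intro has_vector_derivative_add Fh) simp
    moreover have "(\<lambda>h. F h a + integral {a..u} (G h)) = (\<lambda>h. F h u)"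
      using integral_unique[OF ftc[OF that]] by (simp add: fun_eq_iff)
    ultimately show ?thesis
      using Fh vector_derivative_unique_at by metis
  qed
  have "continuous_on {a..t+1} (K h)"
    using continuous_on_compose2[OF cont continuous_on_Pair[OF continuous_on_const continuous_on_id]]
    by simp
  then have "((\<lambda>u. W h a + integral {a..u} (K h)) has_vector_derivative 0 + K h t) (at t within {a..t+1})"
    by (intro has_vector_derivative_add integral_has_vector_derivative) (auto simp: a_def)
  then have "((\<lambda>u. W h a + integral {a..u} (K h)) has_vector_derivative K h t) (at t)"
    using at_within_interior[of t "{a..t+1}"] by (simp add: a_def)
  then show ?thesis
    by (rule has_vector_derivative_transform_within_open[where S = "{a<..<t+1}"])
      (auto simp: W_eq[symmetric], simp_all add: a_def)
qed

section \<open>Calculus of smooth maps\<close>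

lemma smooth_map_has_derivative:
  assumes "smooth_map f"
  shows "(f has_derivative frechet_derivative f (at x)) (at x)"
proof -
  have "C_diff (Suc 0) f"
    using assms by (simp only: smooth_map_def)
  then have "f differentiable (at x)"
    by simp
  then show ?thesis
    by (rule frechet_derivative_works[THEN iffD1])
qed

lemma smooth_map_frechet_derivative:
  assumes "smooth_map f"
  shows "smooth_map (\<lambda>x. frechet_derivative f (at x) w)"
  unfolding smooth_map_def
proof
  fix k
  have "C_diff (Suc k) f"
    using assms by (simp only: smooth_map_def)
  then show "C_diff k (\<lambda>x. frechet_derivative f (at x) w)" by simp
qed

lemma smooth_map_continuous_on: "smooth_map f \<Longrightarrow> continuous_on S f"
  by (auto intro!: continuous_at_imp_continuous_on has_derivative_continuous[OF smooth_map_has_derivative])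

lemma smooth_map_linear:
  "smooth_map f \<Longrightarrow> bounded_linear (frechet_derivative f (at x))"
  by (rule has_derivative_bounded_linear[OF smooth_map_has_derivative])

text \<open>\<open>smooth_map\<close> speaks of derivatives along a fixed vector only; a direction
  that varies with the point is reduced to these through the basis.\<close>

lemma smooth_map_basis_expansion:
  fixes f :: "'a::euclidean_space \<Rightarrow> 'b::real_normed_vector"
  assumes "smooth_map f"
  shows "frechet_derivative f (at x) w = (\<Sum>b\<in>Basis. (w \<bullet> b) *\<^sub>R frechet_derivative f (at x) b)"
proof -
  interpret bounded_linear "frechet_derivative f (at x)"
    by (rule smooth_map_linear[OF assms])
  show ?thesis
    by (subst (1) euclidean_representation[of w, symmetric]) (simp add: sum scaleR)
qed

lemma smooth_map_continuous_on_derivative: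
  fixes f :: "'a::euclidean_space \<Rightarrow> 'b::real_normed_vector"
  assumes f: "smooth_map f" and p: "continuous_on S p" and w: "continuous_on S w"
  shows "continuous_on S (\<lambda>t. frechet_derivative f (at (p t)) (w t))"
proof -
  have "continuous_on S (\<lambda>t. frechet_derivative f (at (p t)) b)" for b
    using smooth_map_continuous_on[OF smooth_map_frechet_derivative[OF f]] p
    by (rule continuous_on_compose2) auto
  then show ?thesis
    by (subst smooth_map_basis_expansion[OF f]) (auto intro!: continuous_intros w)
qed

lemma smooth_map_vector_derivative:
  assumes "smooth_map f" "(c has_vector_derivative c') (at t)"
  shows "((\<lambda>t. f (c t)) has_vector_derivative frechet_derivative f (at (c t)) c') (at t)"
  using vector_derivative_diff_chain_within[OF assms(2), of f "frechet_derivative f (at (c t))"]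
    has_derivative_at_withinI[OF smooth_map_has_derivative[OF assms(1)]] by (simp add: o_def)

text \<open>On the plane of points \<open>x + h v + t w\<close>,
  \<open>mixed_vector_derivative\<close> and the chain rule compute the same derivative in
  \<open>t\<close> at the origin.\<close>

lemma smooth_map_second_derivative_symmetric:
  fixes f :: "'a::euclidean_space \<Rightarrow> 'b::banach"
  assumes f: "smooth_map f"
  shows "frechet_derivative (\<lambda>y. frechet_derivative f (at y) v) (at x) w =
    frechet_derivative (\<lambda>y. frechet_derivative f (at y) w) (at x) v"
proof -
  define p where "p h t = x + h *\<^sub>R v + t *\<^sub>R w" for h t :: real
  have ph: "((\<lambda>h. p h t) has_vector_derivative v) (at h)" for h t
    unfolding p_def by (auto intro!: derivative_eq_intros)
  have pt: "(p h has_vector_derivative w) (at t)" for h t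
    unfolding p_def by (auto intro!: derivative_eq_intros)
  have pc: "continuous_on UNIV (\<lambda>(h, t). p h t)"
    unfolding p_def split_def by (intro continuous_intros)
  note s = smooth_map_vector_derivative
  have "((\<lambda>t. frechet_derivative f (at (p 0 t)) v) has_vector_derivative
      frechet_derivative (\<lambda>y. frechet_derivative f (at y) w) (at (p 0 0)) v) (at 0)"
    using pc
    by (intro mixed_vector_derivative[where F = "\<lambda>h t. f (p h t)" and
        G = "\<lambda>h t. frechet_derivative f (at (p h t)) w" and
        K = "\<lambda>h t. frechet_derivative (\<lambda>y. frechet_derivative f (at y) w) (at (p h t)) v"])
      (auto intro!: s f ph pt smooth_map_frechet_derivative smooth_map_continuous_on_derivative
        continuous_on_const simp: split_def)
  moreover have "((\<lambda>t. frechet_derivative f (at (p 0 t)) v) has_vector_derivative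
      frechet_derivative (\<lambda>y. frechet_derivative f (at y) v) (at (p 0 0)) w) (at 0)"
    by (intro s f pt smooth_map_frechet_derivative)
  ultimately show ?thesis
    using vector_derivative_unique_at by (fastforce simp: p_def)
qed

section \<open>Algebraic laws of the bracket of vector fields\<close>

lemma smooth_map_zero: "smooth_map (0 :: 'a::real_normed_vector \<Rightarrow> 'b::real_normed_vector)"
proof -
  have "C_diff k (\<lambda>x::'a. 0::'b)" for k
    by (induction k) (auto simp: frechet_derivative_const)
  then show ?thesis
    by (simp add: smooth_map_def zero_fun_def)
qed

lemma vf_bracket_zero_right: "smooth_map A \<Longrightarrow> vf_bracket A 0 = 0"
  by (simp add: vf_bracket_def fun_eq_iff zero_fun_def frechet_derivative_const
      linear_0[OF bounded_linear.linear[OF smooth_map_linear]])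

lemma vf_bracket_antisym: "vf_bracket A B = - vf_bracket B A"
  by (simp add: vf_bracket_def fun_eq_iff)

lemma frechet_derivative_add_scaleR:
  assumes "smooth_map A" "smooth_map B"
  shows "frechet_derivative (A + c *\<^sub>R B) (at x) w =
    frechet_derivative A (at x) w + c *\<^sub>R frechet_derivative B (at x) w"
proof -
  have "((\<lambda>x. A x + c *\<^sub>R B x) has_derivative
     (\<lambda>w. frechet_derivative A (at x) w + c *\<^sub>R frechet_derivative B (at x) w)) (at x)"
    by (auto intro!: derivative_intros smooth_map_has_derivative assms)
  then show ?thesis
    by (subst frechet_derivative_at[symmetric]) (auto simp: plus_fun_def scaleR_fun_def)
qed

lemma vf_bracket_add_scaleR_right:
  assumes "smooth_map A" "smooth_map B" "smooth_map C"
  shows "vf_bracket A (B + c *\<^sub>R C) = vf_bracket A B + c *\<^sub>R vf_bracket A C"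
proof
  fix x
  interpret bounded_linear "frechet_derivative A (at x)"
    by (rule smooth_map_linear[OF assms(1)])
  show "vf_bracket A (B + c *\<^sub>R C) x = (vf_bracket A B + c *\<^sub>R vf_bracket A C) x"
    by (simp add: vf_bracket_def frechet_derivative_add_scaleR assms add scaleR scaleR_diff_right)
qed

text \<open>The product rule for \<open>y\<close> mapped to \<open>DF_y (H y)\<close>, with
  \<open>H y\<close> expanded in the basis; symmetry of second derivatives collects the expanded
  terms into one second derivative in the direction \<open>H x\<close>.\<close>

lemma frechet_derivative_vf_bracket:
  fixes A B :: "'n::finite vfield"
  assumes A: "smooth_map A" and B: "smooth_map B"
  shows "frechet_derivative (vf_bracket A B) (at x) w =
    frechet_derivative B (at x) (frechet_derivative A (at x) w)
    + frechet_derivative (\<lambda>y. frechet_derivative B (at y) w) (at x) (A x)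
    - frechet_derivative A (at x) (frechet_derivative B (at x) w)
    - frechet_derivative (\<lambda>y. frechet_derivative A (at y) w) (at x) (B x)"
proof -
  have half: "((\<lambda>y. frechet_derivative F (at y) (H y)) has_derivative
     (\<lambda>w. frechet_derivative F (at x) (frechet_derivative H (at x) w)
        + frechet_derivative (\<lambda>y. frechet_derivative F (at y) w) (at x) (H x))) (at x)"
    if F: "smooth_map F" and H: "smooth_map H" for F H :: "'n vfield"
  proof -
    have "((\<lambda>y. \<Sum>b\<in>Basis. (H y \<bullet> b) *\<^sub>R frechet_derivative F (at y) b) has_derivative
      (\<lambda>w. \<Sum>b\<in>Basis. (H x \<bullet> b) *\<^sub>R frechet_derivative (\<lambda>y. frechet_derivative F (at y) b) (at x) w
         + (frechet_derivative H (at x) w \<bullet> b) *\<^sub>R frechet_derivative F (at x) b)) (at x)"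
      by (auto intro!: derivative_eq_intros smooth_map_has_derivative smooth_map_frechet_derivative F H)
    moreover have "(\<Sum>b\<in>Basis. (H x \<bullet> b) *\<^sub>R frechet_derivative (\<lambda>y. frechet_derivative F (at y) b) (at x) w)
       = frechet_derivative (\<lambda>y. frechet_derivative F (at y) w) (at x) (H x)" for w
      by (subst smooth_map_second_derivative_symmetric[OF F])
        (rule smooth_map_basis_expansion[OF smooth_map_frechet_derivative[OF F], symmetric])
    ultimately show ?thesis
      by (simp add: smooth_map_basis_expansion[OF F, of _ "H _", symmetric]
          smooth_map_basis_expansion[OF F, of _ "frechet_derivative H _ _", symmetric]
          sum.distrib add.commute)
  qed
  have "(vf_bracket A B has_derivative (\<lambda>w.
     (frechet_derivative B (at x) (frechet_derivative A (at x) w)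
        + frechet_derivative (\<lambda>y. frechet_derivative B (at y) w) (at x) (A x))
     - (frechet_derivative A (at x) (frechet_derivative B (at x) w)
        + frechet_derivative (\<lambda>y. frechet_derivative A (at y) w) (at x) (B x)))) (at x)"
    unfolding vf_bracket_def by (intro has_derivative_diff half A B)
  then show ?thesis
    by (subst frechet_derivative_at[symmetric]) (auto simp: algebra_simps)
qed

text \<open>Second derivatives cancel by symmetry, compositions of first derivatives cancel
  outright. The form is the derivation rule for bracketing on the right, matching the left-nested
  brackets of the generalized structure constants.\<close>

lemma vf_bracket_Jacobi:
  fixes A B C :: "'n::finite vfield"
  assumes A: "smooth_map A" and B: "smooth_map B" and C: "smooth_map C"
  shows "vf_bracket (vf_bracket A B) C = vf_bracket (vf_bracket A C) B + vf_bracket A (vf_bracket B C)"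
proof
  fix x
  have lin: "frechet_derivative F (at x) (v - w) =
      frechet_derivative F (at x) v - frechet_derivative F (at x) w"
    if "smooth_map F" for F :: "'n vfield" and v w
    using smooth_map_linear[OF that] bounded_linear.linear linear_diff by blast
  have at: "vf_bracket F G x = frechet_derivative G (at x) (F x) - frechet_derivative F (at x) (G x)"
    for F G :: "'n vfield"
    by (simp add: vf_bracket_def)
  note deriv = frechet_derivative_vf_bracket
  show "vf_bracket (vf_bracket A B) C x =
      (vf_bracket (vf_bracket A C) B + vf_bracket A (vf_bracket B C)) x"
    unfolding plus_fun_apply at deriv[OF A B] deriv[OF A C] deriv[OF B C] lin[OF A] lin[OF B] lin[OF C]
    using smooth_map_second_derivative_symmetric[OF A, of "B x" x "C x"]
      smooth_map_second_derivative_symmetric[OF B, of "C x" x "A x"]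
      smooth_map_second_derivative_symmetric[OF C, of "A x" x "B x"]
    by simp
qed

section \<open>Left-invariant fields and their integral curves\<close>

text \<open>Gronwall argument: if \<open>K\<close> bounds the operators \<open>A t\<close> on
  \<open>{0..T}\<close>, then \<open>exp (- 2 * K * t)\<close> times the squared norm of
  \<open>V t\<close> is nonincreasing, nonnegative and zero at \<open>t = 0\<close>.\<close>

lemma linear_ode_zero_nonneg:
  fixes V :: "real \<Rightarrow> 'a::euclidean_space"
  assumes V: "\<And>t. (V has_vector_derivative A t (V t)) (at t)" and V0: "V 0 = 0"
    and lin: "\<And>t. linear (A t)" and cont: "\<And>v. continuous_on UNIV (\<lambda>t. A t v)"
    and T: "0 \<le> T"
  shows "V T = 0"
proof -
  define k where "k t = (\<Sum>b\<in>Basis. norm (A t b))" for t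
  have "continuous_on {0..T} k"
    unfolding k_def by (intro continuous_intros continuous_on_subset[OF cont]) auto
  then have "bounded (k ` {0..T})"
    by (intro compact_imp_bounded compact_continuous_image) auto
  then obtain K where "\<forall>x\<in>k ` {0..T}. norm x \<le> K"
    unfolding bounded_iff by blast
  then have K: "k t \<le> K" if "0 \<le> t" "t \<le> T" for t
    using that by (auto simp: abs_le_iff)
  have A_bound: "norm (A t v) \<le> K * norm v" if "0 \<le> t" "t \<le> T" for t v
  proof -
    have "A t v = (\<Sum>b\<in>Basis. (v \<bullet> b) *\<^sub>R A t b)"
      by (subst (1) euclidean_representation[of v, symmetric])
        (simp add: linear_sum[OF lin] linear_scale[OF lin])
    also have "norm \<dots> \<le> (\<Sum>b\<in>Basis. norm v * norm (A t b))"
      by (intro sum_norm_le) (simp add: Basis_le_norm mult_right_mono)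
    also have "\<dots> = norm v * k t"
      by (simp add: k_def sum_distrib_left)
    also have "\<dots> \<le> norm v * K"
      using K that by (intro mult_left_mono) auto
    finally show ?thesis by (simp add: mult.commute)
  qed
  define f where "f t = exp (- 2 * K * t) * (V t \<bullet> V t)" for t
  define f' where "f' t = exp (- 2 * K * t) * (2 * (V t \<bullet> A t (V t)) - 2 * K * (V t \<bullet> V t))" for t
  have "(f has_real_derivative f' t) (at t)" for t
  proof -
    have "((\<lambda>t. V t \<bullet> V t) has_real_derivative 2 * (V t \<bullet> A t (V t))) (at t)"
      unfolding has_field_derivative_def
      by (rule has_derivative_eq_rhs[OF has_derivative_inner[OF V[unfolded has_vector_derivative_def]
              V[unfolded has_vector_derivative_def]]])
        (simp add: fun_eq_iff inner_commute)
    moreover have "((\<lambda>t. exp (- 2 * K * t)) has_real_derivative exp (- 2 * K * t) * (- 2 * K)) (at t)"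
      by (auto intro!: derivative_eq_intros)
    ultimately show ?thesis
      unfolding f_def f'_def by (auto dest: DERIV_mult simp: algebra_simps)
  qed
  moreover have "f' t \<le> 0" if "0 \<le> t" "t \<le> T" for t
  proof -
    have "V t \<bullet> A t (V t) \<le> norm (V t) * norm (A t (V t))"
      by (rule norm_cauchy_schwarz)
    also have "\<dots> \<le> norm (V t) * (K * norm (V t))"
      using A_bound that by (intro mult_left_mono) auto
    also have "\<dots> = K * (V t \<bullet> V t)"
      by (simp add: power2_norm_eq_inner[symmetric] power2_eq_square)
    finally show ?thesis
      unfolding f'_def by (intro mult_nonneg_nonpos) auto
  qed
  ultimately have "f T \<le> f 0"
    by (intro DERIV_nonpos_imp_nonincreasing[OF T]) auto
  then have "V T \<bullet> V T \<le> 0"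
    by (simp add: f_def V0 mult_le_0_iff)
  then show ?thesis
    by (metis inner_gt_zero_iff not_less)
qed

lemma linear_ode_zero:
  fixes V :: "real \<Rightarrow> 'a::euclidean_space"
  assumes V: "\<And>t. (V has_vector_derivative A t (V t)) (at t)" and V0: "V 0 = 0"
    and lin: "\<And>t. linear (A t)" and cont: "\<And>v. continuous_on UNIV (\<lambda>t. A t v)"
  shows "V t = 0"
proof (cases "0 \<le> t")
  case True
  then show ?thesis
    by (rule linear_ode_zero_nonneg[OF assms])
next
  case False
  \<comment> \<open>Time reversal reduces negative times to the previous lemma.\<close>
  have "((\<lambda>t. V (- t)) has_vector_derivative - A (- t) (V (- t))) (at t)" for t
  proof -
    have "(uminus has_vector_derivative - 1) (at t)"
      by (auto intro!: derivative_eq_intros)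
    from vector_diff_chain_at[OF this V] show ?thesis
      by (simp add: o_def)
  qed
  moreover have "continuous_on UNIV (\<lambda>t. - A (- t) v)" for v
    by (intro continuous_on_minus continuous_on_compose2[OF cont] continuous_intros) auto
  ultimately have "V (- (- t)) = 0"
    using linear_ode_zero_nonneg[of "\<lambda>t. V (- t)" "\<lambda>t v. - A (- t) v" "- t"] V0 lin False
    by (auto intro: linear_compose_neg)
  then show ?thesis by simp
qed

lemma sum_fun_apply: "(\<Sum>i\<in>I. f i) x = (\<Sum>i\<in>I. f i x)" for f :: "'i \<Rightarrow> 'a \<Rightarrow> 'b::comm_monoid_add"
  by (induction I rule: infinite_finite_induct) auto

text \<open>The series of \<open>e^{tD} u\<close> cut off before order \<open>N\<close>; it is the
  full exponential once \<open>(D ^^ m) u\<close> vanishes for all \<open>m \<ge> N\<close>.\<close>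

definition lexp :: "nat \<Rightarrow> ('a::real_vector \<Rightarrow> 'a) \<Rightarrow> real \<Rightarrow> 'a \<Rightarrow> 'a" where
  "lexp N D t u = (\<Sum>m<N. (t ^ m / fact m) *\<^sub>R (D ^^ m) u)"

lemma lexp_Suc: "lexp (Suc N) D t u = lexp N D t u + (t ^ N / fact N) *\<^sub>R (D ^^ N) u"
  by (simp add: lexp_def)

lemma power_over_fact_derivative:
  "((\<lambda>t. (- t) ^ Suc m / fact (Suc m)) has_vector_derivative - ((- t) ^ m / fact m :: real)) (at t)"
proof -
  have "((\<lambda>t. (- t) ^ Suc m / fact (Suc m)) has_real_derivative - ((- t) ^ m / fact m :: real)) (at t)"
    by (rule derivative_eq_intros refl | simp)+
  then show ?thesis
    by (simp add: has_real_derivative_iff_has_vector_derivative)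
qed

text \<open>Along \<open>c\<close>, the field \<open>(ad X)^m Y\<close> has derivative
  \<open>(ad X)^(m+1) Y + DX ((ad X)^m Y)\<close>. The first summands cancel against the derivatives
  of the coefficients except at the top order, so for nilpotent \<open>ad X\<close> the field
  \<open>e^{-t ad X} Y\<close> solves the variational equation of \<open>X\<close>.\<close>

lemma lexp_along_integral_curve:
  assumes c: "\<And>t. (c has_vector_derivative X (c t)) (at t)"
    and X: "smooth_map X" and Y: "\<And>m. smooth_map ((vf_bracket X ^^ m) Y)"
  shows "((\<lambda>t. lexp (Suc N) (vf_bracket X) (- t) Y (c t)) has_vector_derivative
    frechet_derivative X (at (c t)) (lexp (Suc N) (vf_bracket X) (- t) Y (c t))
    + ((- t) ^ N / fact N) *\<^sub>R (vf_bracket X ^^ Suc N) Y (c t)) (at t)"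
proof -
  interpret DX: bounded_linear "frechet_derivative X (at (c t))"
    by (rule smooth_map_linear[OF X])
  let ?Y = "\<lambda>m. (vf_bracket X ^^ m) Y"
  have bracket: "frechet_derivative (?Y m) (at (c t)) (X (c t)) =
      ?Y (Suc m) (c t) + frechet_derivative X (at (c t)) (?Y m (c t))" for m
    by (simp add: vf_bracket_def)
  have Y': "((\<lambda>t. ?Y m (c t)) has_vector_derivative
      ?Y (Suc m) (c t) + frechet_derivative X (at (c t)) (?Y m (c t))) (at t)" for m
    unfolding bracket[symmetric] by (rule smooth_map_vector_derivative[OF Y c])
  show ?thesis
  proof (induction N)
    case 0
    then show ?case
      using Y'[of 0] by (simp add: lexp_def add.commute)
  next
    case (Suc N)
    have "((\<lambda>t. ((- t) ^ Suc N / fact (Suc N)) *\<^sub>R ?Y (Suc N) (c t)) has_vector_derivative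
      ((- t) ^ Suc N / fact (Suc N)) *\<^sub>R
        (?Y (Suc (Suc N)) (c t) + frechet_derivative X (at (c t)) (?Y (Suc N) (c t)))
      + (- ((- t) ^ N / fact N)) *\<^sub>R ?Y (Suc N) (c t)) (at t)"
      by (intro has_vector_derivative_scaleR Y')
        (use power_over_fact_derivative in \<open>simp add: has_real_derivative_iff_has_vector_derivative\<close>)
    from has_vector_derivative_add[OF Suc this]
    show ?case
      by (subst (1 2) lexp_Suc)
        (simp add: DX.add DX.scaleR scaleR_add_right algebra_simps del: funpow.simps fact_Suc power_Suc)
  qed
qed

lemma continuous_integral_curve:
  "(\<And>t. (c has_vector_derivative c' t) (at t)) \<Longrightarrow> continuous_on S c"
  by (auto intro!: continuous_at_imp_continuous_on has_vector_derivative_continuous)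

section \<open>Translations in a Lie group\<close>

locale lie_group =
  fixes mul :: "real ^ 'n::finite \<Rightarrow> real ^ 'n \<Rightarrow> real ^ 'n" and e iv
  assumes lie: "lie_group_on mul e iv"
begin

sublocale grp: Groups.group mul e iv
  using lie by (simp add: lie_group_on_def)

lemma mul_smooth: "smooth_map (\<lambda>(p, q). mul p q)"
  using lie by (simp add: lie_group_on_def)

abbreviation Dmul where
  "Dmul p q \<equiv> frechet_derivative (\<lambda>(p, q). mul p q) (at (p, q))"

lemma mul_left_has_derivative: "(mul p has_derivative (\<lambda>w. Dmul p q (0, w))) (at q)"
proof -
  have "((\<lambda>q. (p, q)) has_derivative (\<lambda>w. (0, w))) (at q)"
    by (intro derivative_intros)
  from has_derivative_compose[OF this smooth_map_has_derivative[OF mul_smooth]] show ?thesis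
    by simp
qed

lemma mul_right_has_derivative: "((\<lambda>p. mul p q) has_derivative (\<lambda>w. Dmul p q (w, 0))) (at p)"
proof -
  have "((\<lambda>p. (p, q)) has_derivative (\<lambda>w. (w, 0))) (at p)"
    by (intro derivative_intros)
  from has_derivative_compose[OF this smooth_map_has_derivative[OF mul_smooth]] show ?thesis
    by simp
qed

abbreviation "DR q p \<equiv> frechet_derivative (\<lambda>p. mul p q) (at p)"

lemma DR_eq: "DR q p w = Dmul p q (w, 0)"
  by (simp add: frechet_derivative_at[OF mul_right_has_derivative, symmetric])

lemma DR_has_derivative: "((\<lambda>p. mul p q) has_derivative DR q p) (at p)"
  using mul_right_has_derivative by (simp add: DR_eq[abs_def])

lemma left_inv_smooth: "A \<in> left_inv_fields mul \<Longrightarrow> smooth_map A"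
  by (simp add: left_inv_fields_def)

lemma left_inv_mul: "A \<in> left_inv_fields mul \<Longrightarrow> A (mul p q) = Dmul p q (0, A q)"
  using frechet_derivative_at[OF mul_left_has_derivative, of p q, symmetric]
  by (simp add: left_inv_fields_def)

text \<open>Any point \<open>y\<close> is the left translate of \<open>x\<close> by
  \<open>mul y (iv x)\<close>, so the value at \<open>x\<close> determines a left-invariant
  field.\<close>

lemma left_inv_eqI:
  assumes "A \<in> left_inv_fields mul" "B \<in> left_inv_fields mul" "A x = B x"
  shows "A = B"
proof
  fix y
  have "y = mul (mul y (iv x)) x"
    by (simp add: grp.assoc)
  then show "A y = B y"
    using left_inv_mul[OF assms(1), of "mul y (iv x)" x] left_inv_mul[OF assms(2), of "mul y (iv x)" x]
    by (simp add: assms(3))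
qed

lemma left_translate_curve:
  assumes "A \<in> left_inv_fields mul" "(c has_vector_derivative A (c t)) (at t)"
  shows "((\<lambda>t. mul p (c t)) has_vector_derivative A (mul p (c t))) (at t)"
  using vector_derivative_diff_chain_within[OF assms(2)
      has_derivative_at_withinI[OF mul_left_has_derivative]]
  by (simp add: o_def left_inv_mul[OF assms(1)])

lemma right_translate_curve:
  assumes "(c has_vector_derivative c') (at t)"
  shows "((\<lambda>t. mul (c t) q) has_vector_derivative DR q (c t) c') (at t)"
  using vector_derivative_diff_chain_within[OF assms has_derivative_at_withinI[OF DR_has_derivative]]
  by (simp add: o_def)

lemma mul_line_has_vector_derivative:
  "((\<lambda>h. mul (p + h *\<^sub>R w) q) has_vector_derivative DR q (p + h *\<^sub>R w) w) (at h)"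
  by (rule right_translate_curve) (auto intro!: derivative_eq_intros)

text \<open>Both sides solve the variational equation of the flow \<open>p \<mapsto> mul p (\<gamma> t)\<close> of \<open>A\<close>; on the right
  this is where the bracket of vector fields enters.\<close>

lemma DR_integral_curve:
  assumes A: "A \<in> left_inv_fields mul"
    and \<gamma>0: "\<gamma> 0 = e" and \<gamma>: "\<And>t. (\<gamma> has_vector_derivative A (\<gamma> t)) (at t)"
    and B: "\<And>m. smooth_map ((vf_bracket A ^^ m) B)" and N: "(vf_bracket A ^^ N) B = 0"
  shows "DR (\<gamma> t) p (B p) = lexp N (vf_bracket A) (- t) B (mul p (\<gamma> t))"
proof (cases N)
  case 0
  then have "B = 0"
    using N by simp
  then show ?thesis
    using linear_0[OF has_derivative_linear[OF DR_has_derivative, of "\<gamma> t" p]]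
    by (simp add: lexp_def 0)
next
  case (Suc M)
  note As = left_inv_smooth[OF A]
  define c where "c t = mul p (\<gamma> t)" for t
  \<comment> \<open>\<open>W h t\<close> is the derivative in \<open>h\<close> of
    \<open>mul (p + h *\<^sub>R B p) (\<gamma> t)\<close>; \<open>h\<close> stays variable so that
    \<open>mixed_vector_derivative\<close> can turn the flow equation in \<open>t\<close> into the
    variational equation for \<open>W\<close>.\<close>
  define W where "W h t = DR (\<gamma> t) (p + h *\<^sub>R B p) (B p)" for h t
  define U where "U t = lexp N (vf_bracket A) (- t) B (c t)" for t
  have c: "(c has_vector_derivative A (c t)) (at t)" for t
    unfolding c_def by (rule left_translate_curve[OF A \<gamma>])
  have \<gamma>c: "continuous_on S \<gamma>" for S
    using \<gamma> by (rule continuous_integral_curve)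
  have m: "continuous_on S (\<lambda>x. mul (f x) (g x))"
    if "continuous_on S f" "continuous_on S g" for S and f g :: "real \<times> real \<Rightarrow> real ^ 'n"
    using continuous_on_compose2[OF smooth_map_continuous_on[OF mul_smooth, of UNIV]
        continuous_on_Pair[OF that]] by simp
  have "(W 0 has_vector_derivative
      frechet_derivative A (at (mul (p + 0 *\<^sub>R B p) (\<gamma> t))) (W 0 t)) (at t)" for t
  proof (rule mixed_vector_derivative[where F = "\<lambda>h t. mul (p + h *\<^sub>R B p) (\<gamma> t)"])
    show "((\<lambda>t. mul (p + h *\<^sub>R B p) (\<gamma> t)) has_vector_derivative
        A (mul (p + h *\<^sub>R B p) (\<gamma> t))) (at t)" for h t
      by (rule left_translate_curve[OF A \<gamma>])
    show "((\<lambda>h. mul (p + h *\<^sub>R B p) (\<gamma> t)) has_vector_derivative W h t) (at h)" for h t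
      unfolding W_def by (rule mul_line_has_vector_derivative)
    show "((\<lambda>h. A (mul (p + h *\<^sub>R B p) (\<gamma> t))) has_vector_derivative
        frechet_derivative A (at (mul (p + h *\<^sub>R B p) (\<gamma> t))) (W h t)) (at h)" for h t
      unfolding W_def by (intro smooth_map_vector_derivative As mul_line_has_vector_derivative)
    show "continuous_on UNIV
        (\<lambda>(h, t). frechet_derivative A (at (mul (p + h *\<^sub>R B p) (\<gamma> t))) (W h t))"
      unfolding W_def DR_eq split_def
      by (intro smooth_map_continuous_on_derivative As m mul_smooth[unfolded split_def] continuous_intros
          continuous_on_compose2[OF \<gamma>c]) auto
  qed
  then have W: "(W 0 has_vector_derivative frechet_derivative A (at (c t)) (W 0 t)) (at t)" for t
    by (simp add: c_def)
  have U: "(U has_vector_derivative frechet_derivative A (at (c t)) (U t)) (at t)" for t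
    using lexp_along_integral_curve[OF c As B, of M t] N
    unfolding U_def Suc by (simp del: funpow.simps)
  \<comment> \<open>Both solve the same linear equation with initial value
    \<open>B p\<close>.\<close>
  have "W 0 t - U t = 0"
  proof (rule linear_ode_zero)
    show "((\<lambda>t. W 0 t - U t) has_vector_derivative frechet_derivative A (at (c t)) (W 0 t - U t)) (at t)" for t
      using has_vector_derivative_diff[OF W U]
      by (simp add: linear_diff bounded_linear.linear[OF smooth_map_linear[OF As]])
    show "W 0 0 - U 0 = 0"
    proof -
      have "DR e p (B p) = B p"
        using frechet_derivative_at[of "\<lambda>p. p" "\<lambda>w. w" p] by simp
      moreover have "lexp N (vf_bracket A) 0 B = B"
        unfolding lexp_def Suc by (subst sum.lessThan_Suc_shift) simp
      ultimately show ?thesis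
        by (simp add: W_def U_def c_def \<gamma>0)
    qed
    show "linear (frechet_derivative A (at (c t)))" for t
      by (rule bounded_linear.linear[OF smooth_map_linear[OF As]])
    show "continuous_on UNIV (\<lambda>t. frechet_derivative A (at (c t)) v)" for v
      by (intro smooth_map_continuous_on_derivative As continuous_integral_curve[OF c]) auto
  qed
  then show ?thesis
    by (simp add: W_def U_def c_def)
qed

text \<open>The curve \<open>mul (\<delta> t) (\<gamma> (s - t))\<close> runs from
  \<open>\<gamma> s\<close> to \<open>\<delta> s\<close> and is constant: left invariance makes the
  second factor contribute \<open>- A\<close>, and since \<open>[A, A] = 0\<close>, right
  translation by \<open>\<gamma>\<close> preserves \<open>A\<close>, so the first contributes
  \<open>A\<close>.\<close>

lemma integral_curve_unique:
  assumes A: "A \<in> left_inv_fields mul"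
    and \<gamma>: "\<gamma> 0 = e" "\<And>t. (\<gamma> has_vector_derivative A (\<gamma> t)) (at t)"
    and \<delta>: "\<delta> 0 = e" "\<And>t. (\<delta> has_vector_derivative A (\<delta> t)) (at t)"
  shows "\<gamma> s = \<delta> s"
proof -
  have AA: "vf_bracket A A = 0"
    by (simp add: vf_bracket_def fun_eq_iff)
  have "(vf_bracket A ^^ Suc m) A = 0" for m
  proof (induction m)
    case (Suc m)
    then show ?case
      by (subst funpow.simps(2)) (simp only: o_def vf_bracket_zero_right[OF left_inv_smooth[OF A]])
  qed (simp add: AA)
  then have smooth: "smooth_map ((vf_bracket A ^^ m) A)" for m
    by (cases m) (simp_all add: left_inv_smooth[OF A] smooth_map_zero del: funpow.simps(2))
  have DR: "DR (\<gamma> t) p (A p) = A (mul p (\<gamma> t))" for t p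
    using DR_integral_curve[OF A \<gamma> smooth, of 1 t p] AA by (simp add: lexp_def)
  define c where "c t = mul (\<delta> t) (\<gamma> (s - t))" for t
  have c': "(c has_derivative (\<lambda>h. 0)) (at t)" for t
  proof -
    have "((\<lambda>t. \<gamma> (s - t)) has_vector_derivative - A (\<gamma> (s - t))) (at t)"
    proof -
      have "((\<lambda>t. s - t) has_vector_derivative - 1) (at t)"
        by (auto intro!: derivative_eq_intros)
      from vector_diff_chain_at[OF this \<gamma>(2)] show ?thesis
        by (simp add: o_def)
    qed
    then have "((\<lambda>t. (\<delta> t, \<gamma> (s - t))) has_vector_derivative (A (\<delta> t), - A (\<gamma> (s - t)))) (at t)"
      by (intro has_vector_derivative_Pair \<delta>)
    from smooth_map_vector_derivative[OF mul_smooth this]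
    have "(c has_vector_derivative Dmul (\<delta> t) (\<gamma> (s - t)) (A (\<delta> t), - A (\<gamma> (s - t)))) (at t)"
      by (simp add: c_def[abs_def])
    moreover have "Dmul (\<delta> t) (\<gamma> (s - t)) (A (\<delta> t), - A (\<gamma> (s - t))) =
       Dmul (\<delta> t) (\<gamma> (s - t)) (A (\<delta> t), 0) - Dmul (\<delta> t) (\<gamma> (s - t)) (0, A (\<gamma> (s - t)))"
      using linear_diff[OF bounded_linear.linear[OF smooth_map_linear[OF mul_smooth]], symmetric]
      by simp
    moreover have "\<dots> = 0"
      by (simp add: DR_eq[symmetric] DR left_inv_mul[OF A, symmetric])
    ultimately show ?thesis
      by (simp add: has_vector_derivative_def)
  qed
  have "c 0 = c s"
    using has_derivative_zero_unique[of UNIV c 0 s] c' by auto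
  then show ?thesis
    by (simp add: c_def \<gamma> \<delta>)
qed

end

section \<open>Exponential coordinates of the second type\<close>

lemma lexp_mem:
  assumes "subspace S" "\<And>w. w \<in> S \<Longrightarrow> D w \<in> S" "u \<in> S"
  shows "lexp N D t u \<in> S"
proof -
  have "(D ^^ m) u \<in> S" for m
    using assms by (induction m) auto
  then show ?thesis
    unfolding lexp_def using assms(1) by (auto intro: subspace_sum subspace_scale)
qed

lemma funpow_mem: "(\<And>w. w \<in> S \<Longrightarrow> D w \<in> S) \<Longrightarrow> u \<in> S \<Longrightarrow> (D ^^ m) u \<in> S"
  by (induction m) auto

lemma foldr_mem:
  "(\<And>l w. l \<in> set ls \<Longrightarrow> w \<in> S \<Longrightarrow> f l w \<in> S) \<Longrightarrow> u \<in> S \<Longrightarrow> foldr f ls u \<in> S"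
  by (induction ls) auto

text \<open>\<open>N\<close> is a common nilpotency order, making
  \<open>lexp N (vf_bracket (X l)) t\<close> the full exponential on left-invariant fields.\<close>

locale exponential_coordinates = lie_group mul e iv
  for mul :: "real ^ 'n::finite \<Rightarrow> real ^ 'n \<Rightarrow> real ^ 'n" and e iv +
  fixes coord :: "int \<Rightarrow> 'n" and X :: "int \<Rightarrow> 'n vfield" and N :: nat
  assumes coord: "bij_betw coord {1..int CARD('n)} UNIV"
    and second_type: "second_type_coordinates mul e coord X"
    and subspace: "subspace (left_inv_fields mul)"
    and X_mem: "\<And>l. l \<in> {1..int CARD('n)} \<Longrightarrow> X l \<in> left_inv_fields mul"
    and bracket_mem: "\<And>A B. A \<in> left_inv_fields mul \<Longrightarrow> B \<in> left_inv_fields mul \<Longrightarrow>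
      vf_bracket A B \<in> left_inv_fields mul"
    and nilpotent: "\<And>l B. l \<in> {1..int CARD('n)} \<Longrightarrow> B \<in> left_inv_fields mul \<Longrightarrow>
      (vf_bracket (X l) ^^ N) B = 0"
begin

lemma coord_inj: "k \<in> {1..int CARD('n)} \<Longrightarrow> l \<in> {1..int CARD('n)} \<Longrightarrow> coord k = coord l \<Longrightarrow> k = l"
  using coord by (auto simp: bij_betw_def inj_on_def)

lemma integral_curve_scale:
  assumes "\<And>t. (\<gamma> has_vector_derivative A (\<gamma> t)) (at t)"
  shows "((\<lambda>t. \<gamma> (c * t)) has_vector_derivative (c *\<^sub>R A) (\<gamma> (c * t))) (at t)"
proof -
  have "((\<lambda>t. c * t) has_vector_derivative c) (at t)"
    by (auto intro!: derivative_eq_intros)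
  from vector_diff_chain_at[OF this assms] show ?thesis
    by (simp add: o_def)
qed

text \<open>If \<open>X l\<close> had no integral curve through \<open>e\<close> defined for all times, then \<^const>\<open>lie_exp\<close> would
  take one and the same junk value at all nonzero multiples of \<open>X l\<close>, and a point could not be
  recovered from its coordinates.\<close>

lemma integral_curve_exists:
  assumes l: "l \<in> {1..int CARD('n)}"
  shows "\<exists>\<gamma>. \<gamma> 0 = e \<and> (\<forall>t. (\<gamma> has_vector_derivative X l (\<gamma> t)) (at t))"
proof (rule ccontr)
  assume none: "\<not> ?thesis"
  have junk: "lie_exp e (c *\<^sub>R X l) = (THE y. False)" if c: "c \<noteq> 0" for c
  proof -
    have False
      if \<gamma>: "\<gamma> 0 = e" "\<And>t. (\<gamma> has_vector_derivative (c *\<^sub>R X l) (\<gamma> t)) (at t)" for \<gamma>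
      using integral_curve_scale[OF \<gamma>(2), of "1 / c"] none c \<gamma>(1)
      by (auto dest!: spec[of _ "\<lambda>t. \<gamma> (1 / c * t)"])
    then have "(\<lambda>y. \<exists>\<gamma>. \<gamma> 0 = e \<and> (\<forall>t. (\<gamma> has_vector_derivative (c *\<^sub>R X l) (\<gamma> t)) (at t)) \<and> \<gamma> 1 = y)
        = (\<lambda>y. False)"
      by blast
    then show ?thesis
      unfolding lie_exp_def by simp
  qed
  \<comment> \<open>Two distinct points with a single nonzero coordinate: their \<open>l\<close>-th
    factors are the same junk value and all other factors agree.\<close>
  define p where "p c = axis (coord l) c" for c :: real
  have "lie_exp e ((p 1 $ coord k) *\<^sub>R X k) = lie_exp e ((p 2 $ coord k) *\<^sub>R X k)"
    if "k \<in> {1..int CARD('n)}" for k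
    using coord_inj[OF that l] junk[of 1] junk[of 2] by (cases "k = l") (auto simp: p_def axis_def)
  then have "foldr (\<lambda>k. mul (lie_exp e ((p 1 $ coord k) *\<^sub>R X k))) (rev [1..int CARD('n)]) e =
      foldr (\<lambda>k. mul (lie_exp e ((p 2 $ coord k) *\<^sub>R X k))) (rev [1..int CARD('n)]) e"
    by (intro foldr_cong) auto
  moreover have second: "foldr (\<lambda>k. mul (lie_exp e ((x $ coord k) *\<^sub>R X k))) (rev [1..int CARD('n)]) e = x" for x
    using second_type unfolding second_type_coordinates_def by simp
  ultimately have "p 1 = p 2"
    by (simp only: second)
  then show False
    by (simp add: p_def axis_eq_axis)
qed

text \<open>The one-parameter subgroup \<open>exp (t X\<^sub>l)\<close>; for \<open>l\<close> in
  range the choice is unique by \<open>integral_curve_unique\<close>.\<close>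

definition "flow l = (SOME \<gamma>. \<gamma> 0 = e \<and> (\<forall>t. (\<gamma> has_vector_derivative X l (\<gamma> t)) (at t)))"

lemma
  assumes "l \<in> {1..int CARD('n)}"
  shows flow_0: "flow l 0 = e"
    and flow: "(flow l has_vector_derivative X l (flow l t)) (at t)"
  using someI_ex[OF integral_curve_exists[OF assms]] by (simp_all add: flow_def)

lemma lie_exp_eq_flow:
  assumes l: "l \<in> {1..int CARD('n)}"
  shows "lie_exp e (c *\<^sub>R X l) = flow l c"
  unfolding lie_exp_def
proof (rule the_equality)
  note cX = subspace_scale[OF subspace X_mem[OF l]]
  note curve = integral_curve_scale[OF flow[OF l], of c]
  show "\<exists>\<gamma>. \<gamma> 0 = e \<and> (\<forall>t. (\<gamma> has_vector_derivative (c *\<^sub>R X l) (\<gamma> t)) (at t)) \<and> \<gamma> 1 = flow l c"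
    using curve flow_0[OF l] by (intro exI[of _ "\<lambda>t. flow l (c * t)"]) simp
  show "y = flow l c" if y: "\<exists>\<gamma>. \<gamma> 0 = e \<and>
      (\<forall>t. (\<gamma> has_vector_derivative (c *\<^sub>R X l) (\<gamma> t)) (at t)) \<and> \<gamma> 1 = y" for y
  proof -
    from y obtain \<gamma> where \<gamma>: "\<gamma> 0 = e" "\<And>t. (\<gamma> has_vector_derivative (c *\<^sub>R X l) (\<gamma> t)) (at t)"
      and "\<gamma> 1 = y"
      by blast
    then show ?thesis
      using integral_curve_unique[OF cX \<gamma> _ curve, of 1] flow_0[OF l] by simp
  qed
qed

lemma point_eq: "x = fold (\<lambda>l. mul (flow l (x $ coord l))) [1..int CARD('n)] e"
proof -
  have "x = fold (\<lambda>l. mul (lie_exp e ((x $ coord l) *\<^sub>R X l))) [1..int CARD('n)] e"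
    using second_type[unfolded second_type_coordinates_def foldr_conv_fold rev_rev_ident] by (rule spec)
  also have "\<dots> = fold (\<lambda>l. mul (flow l (x $ coord l))) [1..int CARD('n)] e"
    by (intro fold_cong refl) (simp add: lie_exp_eq_flow)
  finally show ?thesis .
qed

section \<open>Coordinate vectors as values of left-invariant fields\<close>

lemma fold_mul: "fold (\<lambda>l. mul (m l)) ls y = mul (fold (\<lambda>l. mul (m l)) ls e) y"
proof (induction ls arbitrary: y)
  case (Cons l ls)
  show ?case
    using Cons[of "mul (m l) y"] Cons[of "mul (m l) e"] by (simp add: grp.assoc)
qed simp

text \<open>For \<open>q\<close> the product of the flows at times \<open>a l\<close>, first list
  element rightmost, this is \<open>Ad(q^{-1})\<close> on left-invariant fields; the first list
  element acts last.\<close>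

abbreviation Ad_inv where
  "Ad_inv a ls \<equiv> foldr (\<lambda>l. lexp N (vf_bracket (X l)) (- a l)) ls"

lemma Ad_inv_mem:
  "set ls \<subseteq> {1..int CARD('n)} \<Longrightarrow> B \<in> left_inv_fields mul \<Longrightarrow> Ad_inv a ls B \<in> left_inv_fields mul"
  by (intro foldr_mem lexp_mem[OF subspace] bracket_mem X_mem) auto

text \<open>Right translation by the product is translation by its leftmost factor, then by the
  rest. That factor belongs to the last list element, so the list is peeled from the end, each time
  by \<open>DR_integral_curve\<close>.\<close>

lemma DR_product:
  fixes a :: "int \<Rightarrow> real"
  assumes "set ls \<subseteq> {1..int CARD('n)}" "B \<in> left_inv_fields mul"
  defines "m \<equiv> \<lambda>l. mul (flow l (a l))"
  shows "DR (fold m ls e) p (B p) = Ad_inv a ls B (mul p (fold m ls e))"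
  using assms(1,2)
proof (induction ls arbitrary: p B rule: rev_induct)
  case Nil
  then show ?case
    using frechet_derivative_at[of "\<lambda>p. p" "\<lambda>w. w" p] by simp
next
  case (snoc l ls)
  then have l: "l \<in> {1..int CARD('n)}"
    by simp
  let ?q = "fold m ls e" and ?g = "flow l (a l)"
  have "(\<lambda>p. mul p (mul ?g ?q)) = (\<lambda>p. mul (mul p ?g) ?q)"
    by (simp add: grp.assoc)
  then have "DR (mul ?g ?q) p (B p) = DR ?q (mul p ?g) (DR ?g p (B p))"
    by (simp add: frechet_derivative_at[OF has_derivative_compose[OF DR_has_derivative[of ?g p]
            DR_has_derivative[of ?q]], symmetric])
  also have "DR ?g p (B p) = lexp N (vf_bracket (X l)) (- a l) B (mul p ?g)"
    by (intro DR_integral_curve X_mem flow_0 flow nilpotent l left_inv_smooth funpow_mem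
        [of "left_inv_fields mul"] bracket_mem) (use snoc in auto)
  also have "DR ?q (mul p ?g) \<dots> = Ad_inv a ls (lexp N (vf_bracket (X l)) (- a l) B) (mul (mul p ?g) ?q)"
    using snoc.prems l by (intro snoc.IH lexp_mem[OF subspace] bracket_mem X_mem) auto
  finally show ?case
    by (simp add: m_def grp.assoc)
qed

text \<open>Varying the \<open>l\<close>-th coordinate moves only the \<open>l\<close>-th factor.
  The factors to its right carry the velocity \<open>X l\<close> to the field
  \<open>Z\<^sub>l\<close> by \<open>DR_product\<close>; those to its left preserve
  \<open>Z\<^sub>l\<close>, which is left-invariant.\<close>

lemma axis_eq:
  assumes l: "l \<in> {1..int CARD('n)}"
  shows "axis (coord l) 1 = Ad_inv (\<lambda>k. x $ coord k) [1..l - 1] (X l) x"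
proof -
  define m where "m x k = mul (flow k (x $ coord k))" for x k
  define p where "p = fold (m x) [l + 1..int CARD('n)] e"
  define q where "q = fold (m x) [1..l - 1] e"
  \<comment> \<open>\<open>y t\<close> is \<open>x\<close> with its \<open>l\<close>-th coordinate
    replaced by \<open>t\<close>.\<close>
  define y where "y t = x + (t - x $ coord l) *\<^sub>R axis (coord l) 1" for t
  let ?g = "flow l (x $ coord l)" and ?Z = "Ad_inv (\<lambda>k. x $ coord k) [1..l - 1] (X l)"
  have split: "[1..int CARD('n)] = [1..l - 1] @ l # [l + 1..int CARD('n)]"
    using l by (intro upto_split3) auto
  have m: "m (y t) k = m x k" if "k \<in> {1..int CARD('n)}" "k \<noteq> l" for k t
    using that coord_inj[OF _ l, of k] by (auto simp: m_def y_def axis_def)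
  have y: "y t = mul p (mul (flow l t) q)" for t
  proof -
    have "fold (m (y t)) [1..l - 1] e = q" "fold (m (y t)) [l + 1..int CARD('n)] = fold (m x) [l + 1..int CARD('n)]"
      unfolding q_def using l by (auto intro!: fold_cong m simp: fun_eq_iff)
    moreover have "m (y t) l = mul (flow l t)"
      by (simp add: m_def y_def)
    ultimately have "fold (m (y t)) [1..int CARD('n)] e = fold (m x) [l + 1..int CARD('n)] (mul (flow l t) q)"
      unfolding split by simp
    also have "\<dots> = mul p (mul (flow l t) q)"
      unfolding p_def m_def by (rule fold_mul)
    finally show ?thesis
      unfolding m_def point_eq[symmetric] .
  qed
  have x: "mul p (mul ?g q) = x"
    using y[of "x $ coord l"] by (simp add: y_def)
  have "(y has_vector_derivative axis (coord l) 1) (at (x $ coord l))"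
    unfolding y_def by (auto intro!: derivative_eq_intros)
  moreover have "((\<lambda>t. mul p (mul (flow l t) q)) has_vector_derivative
      Dmul p (mul ?g q) (0, DR q ?g (X l ?g))) (at (x $ coord l))"
    using vector_derivative_diff_chain_within[OF right_translate_curve[OF flow[OF l]]
        has_derivative_at_withinI[OF mul_left_has_derivative]]
    by (simp add: o_def)
  moreover have "DR q ?g (X l ?g) = ?Z (mul ?g q)"
    unfolding q_def m_def by (rule DR_product) (use l X_mem in auto)
  moreover have "Dmul p (mul ?g q) (0, ?Z (mul ?g q)) = ?Z (mul p (mul ?g q))"
    using l by (intro left_inv_mul[symmetric] Ad_inv_mem X_mem) auto
  ultimately show ?thesis
    using y x vector_derivative_unique_at[of y "axis (coord l) 1" "x $ coord l"]
    by (simp add: y[abs_def])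
qed

text \<open>With coefficients frozen at \<open>x\<close>, both sides are left-invariant and agree at
  \<open>x\<close> by \<open>axis_eq\<close>, hence everywhere. An identity of fields, unlike one of
  values at \<open>x\<close>, can be inserted into brackets.\<close>

lemma left_inv_expansion:
  assumes A: "A \<in> left_inv_fields mul"
  shows "A = (\<Sum>l\<in>{1..int CARD('n)}. (A x $ coord l) *\<^sub>R Ad_inv (\<lambda>k. x $ coord k) [1..l - 1] (X l))"
    (is "A = (\<Sum>l\<in>_. ?c l *\<^sub>R ?Z l)")
proof (rule left_inv_eqI[where x = x])
  show "(\<Sum>l\<in>{1..int CARD('n)}. ?c l *\<^sub>R ?Z l) \<in> left_inv_fields mul"
    by (intro subspace_sum[OF subspace] subspace_scale[OF subspace] Ad_inv_mem X_mem) auto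
  have "A x = (\<Sum>i\<in>UNIV. (A x $ i) *\<^sub>R axis i 1)"
    using basis_expansion[of "A x"] by (simp add: scalar_mult_eq_scaleR)
  also have "\<dots> = (\<Sum>l\<in>{1..int CARD('n)}. ?c l *\<^sub>R axis (coord l) 1)"
    by (rule sum.reindex_bij_betw[OF coord, symmetric])
  also have "\<dots> = (\<Sum>l\<in>{1..int CARD('n)}. ?c l *\<^sub>R ?Z l) x"
    by (simp add: sum_fun_apply axis_eq[symmetric])
  finally show "A x = (\<Sum>l\<in>{1..int CARD('n)}. ?c l *\<^sub>R ?Z l) x" .
qed (rule A)

end

section \<open>The prolongation of a stratified Lie algebra\<close>

lemma tk_at_scaleR [simp]: "tk_at zs (c *\<^sub>R u) = c *\<^sub>R tk_at zs u"
  by (induction zs arbitrary: u) auto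

lemma tk_at_emb: "tk_at zs (emb A) = (if zs = [] then A else 0)"
  by (cases zs) (auto simp: emb_def)

lemma gpart_emb [simp]: "gpart (emb A) = A" and mpart_emb [simp]: "mpart (emb A) = (\<lambda>_. 0)"
  by (simp_all add: emb_def)

lemma emb_zero [simp]: "emb 0 = 0"
  by (rule tk_at_eqI) (simp add: tk_at_emb)

lemma emb_add_scaleR: "emb (A + c *\<^sub>R B) = emb A + c *\<^sub>R emb B"
  by (rule tk_at_eqI) (simp add: tk_at_emb)

lemma emb_minus: "emb (- A) = - emb A"
  using emb_add_scaleR[of 0 "-1" A] by simp

lemma Tk_zero [simp]: "Tk 0 (\<lambda>_. 0) = 0"
  using emb_zero by (simp add: emb_def)

text \<open>The brackets and exponentials below are linear only on subspaces of their types, so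
  linearity is assumed on \<open>S\<close> alone.\<close>

lemma linear_on_subspace_sum:
  fixes F :: "'a::real_vector \<Rightarrow> 'b::real_vector"
  assumes S: "subspace S"
    and F: "\<And>u w c. u \<in> S \<Longrightarrow> w \<in> S \<Longrightarrow> F (u + c *\<^sub>R w) = F u + c *\<^sub>R F w"
    and I: "finite I" "\<And>i. i \<in> I \<Longrightarrow> w i \<in> S"
  shows "F (\<Sum>i\<in>I. c i *\<^sub>R w i) = (\<Sum>i\<in>I. c i *\<^sub>R F (w i))"
proof -
  have "F (0 + 1 *\<^sub>R 0) = F 0 + 1 *\<^sub>R F 0"
    using subspace_0[OF S] by (intro F)
  then have F0: "F 0 = 0"
    by simp
  show ?thesis
    using I
  proof (induction I rule: finite_induct)
    case (insert i I)
    then show ?case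
      using F[of "\<Sum>i\<in>I. c i *\<^sub>R w i" "w i" "c i"]
      by (simp add: add.commute subspace_sum[OF S] subspace_scale[OF S])
  qed (simp add: F0)
qed

text \<open>Span induction whose step also knows \<open>y \<in> S\<close>, where the brackets are
  linear.\<close>

lemma span_induct_subspace:
  assumes "u \<in> span B" "subspace S" "B \<subseteq> S" "P 0"
    and step: "\<And>c x y. x \<in> B \<Longrightarrow> y \<in> S \<Longrightarrow> P y \<Longrightarrow> P (y + c *\<^sub>R x)"
  shows "P u"
proof -
  have "u \<in> S \<and> P u"
    using assms(1)
  proof (induction rule: span_induct_alt)
    case base
    then show ?case using assms(2,4) subspace_0 by auto
  next
    case (step c x y)
    then show ?case
      using assms(2,3) assms(5)[of x y c] subspace_add[OF assms(2)] subspace_scale[OF assms(2)]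
      by (auto simp: add.commute[of _ y])
  qed
  then show ?thesis ..
qed

locale stratified_algebra =
  fixes g :: "'a::real_vector set" and b :: "'a \<Rightarrow> 'a \<Rightarrow> 'a" and V :: "int \<Rightarrow> 'a set" and s :: int
  assumes subspace_g: "subspace g"
    and b_add_scaleR: "\<And>A B C c. A \<in> g \<Longrightarrow> B \<in> g \<Longrightarrow> C \<in> g \<Longrightarrow> b A (B + c *\<^sub>R C) = b A B + c *\<^sub>R b A C"
    and antisym: "\<And>A B. b A B = - b B A"
    and Jacobi: "\<And>A B C. A \<in> g \<Longrightarrow> B \<in> g \<Longrightarrow> C \<in> g \<Longrightarrow> b (b A B) C = b (b A C) B + b A (b B C)"
    and stratification: "stratification g b V s"
begin

lemma b_add_scaleR_left:
  "A \<in> g \<Longrightarrow> B \<in> g \<Longrightarrow> C \<in> g \<Longrightarrow> b (B + c *\<^sub>R C) A = b B A + c *\<^sub>R b C A"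
  using b_add_scaleR[of A B C c] by (simp add: antisym[of _ A])

lemma b_zero: assumes "A \<in> g" shows "b A 0 = 0" "b 0 A = 0"
proof -
  show "b A 0 = 0"
    using b_add_scaleR[of A 0 0 1] assms subspace_0[OF subspace_g] by simp
  then show "b 0 A = 0"
    using antisym[of 0 A] by simp
qed

section \<open>Layers and degree filtrations\<close>

lemma
  shows subspace_V: "subspace (V k)"
    and V_trivial: "k < 1 \<or> s < k \<Longrightarrow> V k = {0}"
    and V_Suc: "2 \<le> k \<Longrightarrow> V k = span {b A B |A B. A \<in> V (k - 1) \<and> B \<in> V 1}"
    and span_V: "span (\<Union>k\<in>{1..s}. V k) = g"
    and s_ge_1: "1 \<le> s"
proof -
  note strat = stratification[unfolded stratification_def]
  show "subspace (V k)"
    by (rule strat[THEN conjunct2, THEN conjunct2, THEN conjunct1, rule_format])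
  show "k < 1 \<or> s < k \<Longrightarrow> V k = {0}"
    by (rule strat[THEN conjunct2, THEN conjunct2, THEN conjunct2, THEN conjunct1, THEN spec, THEN mp])
  show "2 \<le> k \<Longrightarrow> V k = span {b A B |A B. A \<in> V (k - 1) \<and> B \<in> V 1}"
    by (rule strat[THEN conjunct2, THEN conjunct2, THEN conjunct2, THEN conjunct2, THEN conjunct1,
          THEN spec, THEN mp])
  show "span (\<Union>k\<in>{1..s}. V k) = g"
    by (rule strat[THEN conjunct2, THEN conjunct2, THEN conjunct2, THEN conjunct2, THEN conjunct2,
          THEN conjunct1])
  show "1 \<le> s"
    by (rule strat[THEN conjunct1])
qed

lemma V_subset: "V k \<subseteq> g"
proof (cases "k \<in> {1..s}")
  case True
  then show ?thesis
    using span_superset[of "\<Union>k\<in>{1..s}. V k"] unfolding span_V UN_subset_iff by (rule bspec[rotated])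
next
  case False
  then show ?thesis
    using V_trivial[of k] subspace_0[OF subspace_g] by auto
qed

lemma bracket_V_1: "1 \<le> i \<Longrightarrow> A \<in> V i \<Longrightarrow> B \<in> V 1 \<Longrightarrow> b A B \<in> V (i + 1)"
  using V_Suc[of "i + 1"] by (auto intro!: span_base)

text \<open>By Jacobi, \<open>[A, [C, D]] = [[A, C], D] - [[A, D], C]\<close>, which reduces layer
  \<open>j + 1\<close> to layers \<open>j\<close> and 1; \<open>i\<close> is arbitrary because the
  last term uses the hypothesis at \<open>i + 1\<close>.\<close>

lemma bracket_V:
  assumes "1 \<le> j" "1 \<le> i" "A \<in> V i" "B \<in> V j"
  shows "b A B \<in> V (i + j)"
  using assms
proof (induction j arbitrary: i A B rule: int_ge_induct)
  case base
  then show ?case by (intro bracket_V_1)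
next
  case (step j)
  have A: "A \<in> g"
    using step.prems V_subset by blast
  have "B \<in> span {b C D |C D. C \<in> V j \<and> D \<in> V 1}"
    using step V_Suc[of "j + 1"] by simp
  then show ?case
  proof (rule span_induct_subspace[OF _ subspace_g])
    show gen: "{b C D |C D. C \<in> V j \<and> D \<in> V 1} \<subseteq> g"
      using bracket_V_1[OF step.hyps] V_subset by blast
    show "b A 0 \<in> V (i + (j + 1))"
      using b_zero A subspace_0[OF subspace_V] by simp
    show "b A (y + c *\<^sub>R x) \<in> V (i + (j + 1))"
      if x: "x \<in> {b C D |C D. C \<in> V j \<and> D \<in> V 1}" and y: "y \<in> g" "b A y \<in> V (i + (j + 1))" for c x y
    proof -
      obtain C D where CD: "x = b C D" "C \<in> V j" "D \<in> V 1"
        using x by blast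
      have "b (b A C) D \<in> V (i + j + 1)"
        using step.prems step.hyps CD by (intro bracket_V_1 step.IH) auto
      moreover have "b (b A D) C \<in> V (i + 1 + j)"
        using step.prems CD by (intro step.IH bracket_V_1) auto
      moreover have "b A x = b (b A C) D - b (b A D) C"
        using Jacobi[of A C D] A CD V_subset by fastforce
      ultimately have "b A x \<in> V (i + (j + 1))"
        using subspace_diff[OF subspace_V, of "b (b A C) D" "i + (j + 1)" "b (b A D) C"]
        by (simp only: add_ac)
      then show ?thesis
        using b_add_scaleR[OF A, of y x c] subsetD[OF gen x] y
        by (simp add: subspace_add[OF subspace_V] subspace_scale[OF subspace_V])
    qed
  qed
qed

definition G :: "int \<Rightarrow> 'a set" where
  "G m = span (\<Union>k\<in>{m..s}. V k)"

text \<open>Degrees in the prolongation may be unbounded below, but on one \<open>H m\<close> a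
  number of brackets with \<open>g\<close> depending only on \<open>m\<close> and \<open>s\<close>
  gives zero.\<close>

definition H :: "int \<Rightarrow> 'a tk set" where
  "H m = span (\<Union>k\<in>{m..s}. prol_stratum g b V s k)"

lemma subspace_G: "subspace (G m)" and subspace_H: "subspace (H m)"
  by (simp_all add: G_def H_def)

lemma G_antimono: "m \<le> k \<Longrightarrow> G k \<subseteq> G m" and H_antimono: "m \<le> k \<Longrightarrow> H k \<subseteq> H m"
  unfolding G_def H_def by (intro span_mono UN_mono; auto)+

lemma G_trivial: "s < m \<Longrightarrow> G m = {0}" and H_trivial: "s < m \<Longrightarrow> H m = {0}"
  by (simp_all add: G_def H_def)

lemma G_1: "G 1 = g"
  by (simp add: G_def span_V)

lemma G_subset: "1 \<le> m \<Longrightarrow> G m \<subseteq> g"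
  using G_antimono[of 1 m] G_1 by simp

lemma V_subset_G: "m \<le> k \<Longrightarrow> V k \<subseteq> G m"
proof (cases "k \<le> s")
  case True
  assume "m \<le> k"
  then show ?thesis
    unfolding G_def using True by (intro subset_trans[OF _ span_superset]) auto
next
  case False
  then show ?thesis
    using V_trivial[of k] subspace_0[OF subspace_G] by auto
qed

lemma stratum_subset_H: "m \<le> k \<Longrightarrow> prol_stratum g b V s k \<subseteq> H m"
proof (cases "k \<le> s")
  case True
  assume "m \<le> k"
  then show ?thesis
    unfolding H_def using True by (intro subset_trans[OF _ span_superset]) auto
next
  case False
  then have "prol_stratum g b V s k = {0}"
    using V_trivial[of k] s_ge_1 by (subst prol_stratum.simps) simp
  then show ?thesis
    using subspace_0[OF subspace_H] by auto
qed

lemma H_subset_prol: "H m \<subseteq> prol g b V s"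
  unfolding H_def prol_def by (intro span_mono) auto

lemma bracket_G:
  assumes A: "A \<in> g" and B: "B \<in> G m" and m: "1 \<le> m"
  shows "b A B \<in> G (m + 1)"
proof -
  have V: "b A B \<in> G (m + 1)" if B: "B \<in> V k" "m \<le> k" for B k
  proof -
    have Bg: "B \<in> g"
      using B V_subset by blast
    show ?thesis
      using A[folded span_V]
    proof (rule span_induct_subspace[OF _ subspace_g])
      show "b 0 B \<in> G (m + 1)"
        using Bg b_zero subspace_0[OF subspace_G] by simp
      show "b (y + c *\<^sub>R x) B \<in> G (m + 1)"
        if x: "x \<in> (\<Union>k\<in>{1..s}. V k)" and y: "y \<in> g" "b y B \<in> G (m + 1)" for c x y
      proof -
        obtain i where i: "1 \<le> i" "x \<in> V i"
          using x by auto
        then have "b x B \<in> V (i + k)"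
          using B m by (intro bracket_V) auto
        then have "b x B \<in> G (m + 1)"
          using V_subset_G[of "m + 1" "i + k"] i B by auto
        moreover have "x \<in> g"
          using i V_subset by blast
        ultimately show ?thesis
          using y Bg by (simp add: b_add_scaleR_left subspace_add[OF subspace_G] subspace_scale[OF subspace_G])
      qed
    qed (use V_subset in blast)
  qed
  show ?thesis
    using B unfolding G_def[of m]
  proof (rule span_induct_subspace[OF _ subspace_g])
    show "b A 0 \<in> G (m + 1)"
      using A b_zero subspace_0[OF subspace_G] by simp
    show "b A (y + c *\<^sub>R x) \<in> G (m + 1)"
      if x: "x \<in> (\<Union>k\<in>{m..s}. V k)" and y: "y \<in> g" "b A y \<in> G (m + 1)" for c x y
    proof -
      have "b A x \<in> G (m + 1)" "x \<in> g"
        using x V V_subset by auto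
      then show ?thesis
        using y A by (simp add: b_add_scaleR subspace_add[OF subspace_G] subspace_scale[OF subspace_G])
    qed
  qed (use V_subset in blast)
qed

lemma bracket_mem: "A \<in> g \<Longrightarrow> B \<in> g \<Longrightarrow> b A B \<in> g"
  using bracket_G[of A B 1] G_1 G_subset[of 2] by auto

lemma funpow_bracket_G: "A \<in> g \<Longrightarrow> B \<in> g \<Longrightarrow> (b A ^^ j) B \<in> G (1 + int j)"
proof (induction j)
  case (Suc j)
  then show ?case
    using bracket_G[of A "(b A ^^ j) B" "1 + int j"] by (simp add: add.commute add.left_commute)
qed (simp add: G_1)

lemma bracket_nilpotent: "A \<in> g \<Longrightarrow> B \<in> g \<Longrightarrow> s \<le> int j \<Longrightarrow> (b A ^^ j) B = 0"
  using funpow_bracket_G[of A B j] G_trivial[of "1 + int j"] by auto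

text \<open>The bracket \<open>[u, Y]\<close> of the prolongation with \<open>Y\<close> in \<open>g\<close>; see \<open>prol_bracket_emb_right\<close>.\<close>

definition br :: "'a tk \<Rightarrow> 'a \<Rightarrow> 'a tk" where
  "br u Y = emb (b (gpart u) Y) + mpart u Y"

text \<open>The type of the prolongation contains junk; \<open>prol_bracket b u 0 = 0\<close> fails for some of it.\<close>

definition regular :: "'a tk set" where
  "regular = {u. \<forall>zs. tk_at zs u \<in> g \<and> (0 \<in> set zs \<longrightarrow> tk_at zs u = 0)}"

section \<open>Brackets of regular elements with the Lie algebra\<close>

lemma regularD: "u \<in> regular \<Longrightarrow> tk_at zs u \<in> g" "u \<in> regular \<Longrightarrow> 0 \<in> set zs \<Longrightarrow> tk_at zs u = 0"
  by (auto simp: regular_def)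

lemma subspace_regular: "subspace regular"
  unfolding regular_def subspace_def
  by (auto simp: subspace_0[OF subspace_g] subspace_add[OF subspace_g] subspace_scale[OF subspace_g])

lemma gpart_regular: "u \<in> regular \<Longrightarrow> gpart u \<in> g"
  using regularD(1)[of u "[]"] by simp

lemma mpart_regular: "u \<in> regular \<Longrightarrow> mpart u Z \<in> regular"
  using regularD[of u "Z # zs" for zs] by (auto simp: regular_def)

lemma mpart_0_regular: "u \<in> regular \<Longrightarrow> mpart u 0 = 0"
  using regularD(2)[of u "0 # zs" for zs] by (intro tk_at_eqI) auto

lemma Tk_0_regular:
  assumes "\<And>Z. \<phi> Z \<in> regular" "\<phi> 0 = 0"
  shows "Tk 0 \<phi> \<in> regular"
  unfolding regular_def
proof (intro CollectI allI)
  fix zs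
  show "tk_at zs (Tk 0 \<phi>) \<in> g \<and> (0 \<in> set zs \<longrightarrow> tk_at zs (Tk 0 \<phi>) = 0)"
    using assms regularD[OF assms(1)] subspace_0[OF subspace_g] by (cases zs) auto
qed

text \<open>The recursion passes from \<open>u\<close> to \<open>mpart u Z\<close> and
  \<open>Tk 0 (mpart u)\<close>, both regular; the remaining terms contain
  \<open>mpart u 0 = 0\<close>.\<close>

lemma bracket_at_0:
  "u \<in> regular \<Longrightarrow> bracket_at b zs u 0 = 0 \<and> bracket_at b zs 0 u = 0"
proof (induction zs arbitrary: u)
  case Nil
  show ?case
    using b_zero[OF gpart_regular[OF Nil]] mpart_0_regular[OF Nil] by simp
next
  case (Cons Z zs)
  have "Tk 0 (mpart u) \<in> regular"
    using mpart_regular mpart_0_regular Cons.prems by (intro Tk_0_regular) auto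
  then show ?case
    using Cons.IH mpart_regular[OF Cons.prems] mpart_0_regular[OF Cons.prems] by simp
qed

lemma prol_bracket_0:
  "u \<in> regular \<Longrightarrow> prol_bracket b u 0 = 0" "u \<in> regular \<Longrightarrow> prol_bracket b 0 u = 0"
  by (auto intro!: tk_at_eqI simp: prol_bracket_def bracket_at_0)

text \<open>An embedded element has no map part, so the last term of \<open>prol_bracket_Tk\<close>
  consists of brackets with 0, which vanish on regular elements.\<close>

lemma
  assumes u: "u \<in> regular"
  shows prol_bracket_emb_right: "prol_bracket b u (emb Y) = br u Y"
    and prol_bracket_emb_left: "prol_bracket b (emb Y) u = - br u Y"
proof -
  have r: "Tk 0 (mpart u) \<in> regular"
    using mpart_regular[OF u] mpart_0_regular[OF u] by (intro Tk_0_regular) auto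
  note z = prol_bracket_0[OF r] prol_bracket_0[OF mpart_regular[OF u]]
  show "prol_bracket b u (emb Y) = br u Y"
    using prol_bracket_Tk[of b "gpart u" "mpart u" Y "\<lambda>_. 0"] z by (simp add: br_def emb_def)
  show "prol_bracket b (emb Y) u = - br u Y"
    using prol_bracket_Tk[of b Y "\<lambda>_. 0" "gpart u" "mpart u"] z antisym[of Y "gpart u"]
    by (simp add: br_def emb_def[symmetric] emb_minus)
qed

section \<open>Strata of the prolongation\<close>

lemma stratum_posE:
  assumes "u \<in> prol_stratum g b V s k" "1 \<le> k"
  obtains A where "u = emb A" "A \<in> V k"
  using assms by (subst (asm) prol_stratum.simps) auto

lemma stratum_nonposE:
  assumes "u \<in> prol_stratum g b V s k" "k \<le> 0"
  obtains \<phi> where "u = Tk 0 \<phi>" "linear_map_on g \<phi>"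
    "\<And>i Y. i \<in> {1..s} \<Longrightarrow> Y \<in> V i \<Longrightarrow> \<phi> Y \<in> prol_stratum g b V s (i + k)"
    "\<And>A Y. A \<in> g \<Longrightarrow> Y \<in> g \<Longrightarrow>
      \<phi> (b A Y) = prol_bracket b (\<phi> A) (emb Y) + prol_bracket b (emb A) (\<phi> Y)"
  using assms by (subst (asm) prol_stratum.simps) auto

lemma linear_map_on_add_scaleR:
  "linear_map_on g \<phi> \<Longrightarrow> A \<in> g \<Longrightarrow> B \<in> g \<Longrightarrow> \<phi> (A + c *\<^sub>R B) = \<phi> A + c *\<^sub>R \<phi> B"
  using subspace_scale[OF subspace_g] by (simp add: linear_map_on_def)

lemma linear_map_on_0: "linear_map_on g \<phi> \<Longrightarrow> \<phi> 0 = 0"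
  using linear_map_on_add_scaleR[of \<phi> 0 0 1] subspace_0[OF subspace_g] by simp

text \<open>Induction on the distance to positive degree: an element of degree
  \<open>k \<le> 0\<close> sends \<open>V i\<close>, \<open>i \<ge> 1\<close>, into the stratum of
  degree \<open>i + k > k\<close>, and is zero off \<open>g\<close>.\<close>

lemma stratum_regular: "u \<in> prol_stratum g b V s k \<Longrightarrow> u \<in> regular"
proof (induction "nat (1 - k)" arbitrary: u k rule: less_induct)
  case less
  show ?case
  proof (cases "1 \<le> k")
    case True
    with less.prems obtain A where "u = emb A" "A \<in> V k"
      by (rule stratum_posE)
    then show ?thesis
      using V_subset subspace_0[OF subspace_g] by (auto simp: regular_def tk_at_emb)
  next
    case False
    then have "k \<le> 0"
      by simp
    with less.prems obtain \<phi> where \<phi>: "u = Tk 0 \<phi>" "linear_map_on g \<phi>"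
      "\<And>i Y. i \<in> {1..s} \<Longrightarrow> Y \<in> V i \<Longrightarrow> \<phi> Y \<in> prol_stratum g b V s (i + k)"
      by (rule stratum_nonposE) blast
    have "\<phi> Z \<in> regular" if "Z \<in> g" for Z
      using that[folded span_V]
    proof (rule span_induct_subspace[OF _ subspace_g])
      show "\<phi> 0 \<in> regular"
        using linear_map_on_0[OF \<phi>(2)] subspace_0[OF subspace_regular] by simp
      show "\<phi> (y + c *\<^sub>R x) \<in> regular"
        if x: "x \<in> (\<Union>k\<in>{1..s}. V k)" and y: "y \<in> g" "\<phi> y \<in> regular" for c x y
      proof -
        obtain i where i: "i \<in> {1..s}" "x \<in> V i"
          using x by auto
        then have "\<phi> x \<in> regular"
          using \<phi>(3) False by (intro less.hyps[of "i + k"]) auto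
        moreover have "x \<in> g"
          using i V_subset by blast
        ultimately show ?thesis
          using y by (simp add: linear_map_on_add_scaleR[OF \<phi>(2)] subspace_add[OF subspace_regular]
              subspace_scale[OF subspace_regular])
      qed
    qed (use V_subset in blast)
    moreover have "\<phi> Z = 0" if "Z \<notin> g" for Z
      using \<phi>(2) that by (simp add: linear_map_on_def)
    ultimately have "\<phi> Z \<in> regular" for Z
      using subspace_0[OF subspace_regular] by (cases "Z \<in> g") auto
    then show ?thesis
      unfolding \<phi>(1) using linear_map_on_0[OF \<phi>(2)] by (rule Tk_0_regular)
  qed
qed

lemma H_regular: "H m \<subseteq> regular"
  unfolding H_def using stratum_regular by (intro span_minimal subspace_regular) auto

lemma H_induct [consumes 1, case_names zero step]:
  assumes "u \<in> H m" "P 0"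
    and "\<And>k c x y. m \<le> k \<Longrightarrow> x \<in> prol_stratum g b V s k \<Longrightarrow> y \<in> H m \<Longrightarrow> P y \<Longrightarrow> P (y + c *\<^sub>R x)"
  shows "P u"
  using assms(1) unfolding H_def
  by (rule span_induct_subspace[OF _ subspace_H[of m]])
    (use assms stratum_subset_H in \<open>auto simp: H_def[symmetric] subset_iff\<close>)

lemma br_add_scaleR_left:
  assumes "u \<in> regular" "w \<in> regular" "Y \<in> g"
  shows "br (u + c *\<^sub>R w) Y = br u Y + c *\<^sub>R br w Y"
  using assms gpart_regular
  by (simp add: br_def b_add_scaleR_left emb_add_scaleR scaleR_add_right)

lemma br_0_left: "Y \<in> g \<Longrightarrow> br 0 Y = 0"
  by (simp add: br_def b_zero)

lemma stratum_br_add_scaleR_right: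
  assumes "u \<in> prol_stratum g b V s k" "Y \<in> g" "Z \<in> g"
  shows "br u (Y + c *\<^sub>R Z) = br u Y + c *\<^sub>R br u Z"
proof (cases "1 \<le> k")
  case True
  with assms(1) obtain A where "u = emb A" "A \<in> V k"
    by (rule stratum_posE)
  then show ?thesis
    using assms V_subset by (simp add: br_def b_add_scaleR[of A] emb_add_scaleR subset_iff)
next
  case False
  then have "k \<le> 0"
    by simp
  with assms(1) obtain \<phi> where "u = Tk 0 \<phi>" "linear_map_on g \<phi>"
    by (rule stratum_nonposE)
  then show ?thesis
    using assms subspace_add[OF subspace_g] subspace_scale[OF subspace_g]
    by (simp add: br_def b_zero linear_map_on_add_scaleR)
qed

lemma br_add_scaleR_right:
  assumes "u \<in> H m" "Y \<in> g" "Z \<in> g"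
  shows "br u (Y + c *\<^sub>R Z) = br u Y + c *\<^sub>R br u Z"
  using assms(1)
proof (induction rule: H_induct)
  case zero
  then show ?case
    using assms subspace_add[OF subspace_g] subspace_scale[OF subspace_g] by (simp add: br_0_left)
next
  case (step k a x y)
  then show ?case
    using assms H_regular stratum_regular stratum_br_add_scaleR_right[OF step(2)]
      subspace_add[OF subspace_g] subspace_scale[OF subspace_g]
    by (subst (1 2 3) br_add_scaleR_left) (auto simp: algebra_simps)
qed

lemma stratum_br:
  assumes "u \<in> prol_stratum g b V s k" "i \<in> {1..s}" "Y \<in> V i"
  shows "br u Y \<in> prol_stratum g b V s (k + i)"
proof (cases "1 \<le> k")
  case True
  with assms(1) obtain A where "u = emb A" "A \<in> V k"
    by (rule stratum_posE)
  then show ?thesis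
    using True assms bracket_V[of i k A Y] by (subst prol_stratum.simps) (simp add: br_def)
next
  case False
  then have "k \<le> 0"
    by simp
  with assms(1) obtain \<phi> where "u = Tk 0 \<phi>"
    "\<And>i Y. i \<in> {1..s} \<Longrightarrow> Y \<in> V i \<Longrightarrow> \<phi> Y \<in> prol_stratum g b V s (i + k)"
    by (rule stratum_nonposE) blast
  then show ?thesis
    using assms V_subset by (auto simp: br_def b_zero subset_iff add.commute)
qed

lemma br_H:
  assumes u: "u \<in> H m" and Y: "Y \<in> G i" and i: "1 \<le> i"
  shows "br u Y \<in> H (m + i)"
  using Y unfolding G_def
proof (rule span_induct_subspace[OF _ subspace_g])
  show "br u 0 \<in> H (m + i)"
    using br_add_scaleR_right[OF u, of 0 0 1] subspace_0[OF subspace_g] subspace_0[OF subspace_H]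
    by simp
  show "br u (y + c *\<^sub>R x) \<in> H (m + i)"
    if x: "x \<in> (\<Union>k\<in>{i..s}. V k)" and y: "y \<in> g" "br u y \<in> H (m + i)" for c x y
  proof -
    obtain j where j: "j \<in> {i..s}" "x \<in> V j"
      using x by auto
    then have xg: "x \<in> g"
      using V_subset by blast
    have "br u x \<in> H (m + i)"
      using u
    proof (induction rule: H_induct)
      case zero
      then show ?case
        using xg subspace_0[OF subspace_H] by (simp add: br_0_left)
    next
      case (step k a z w)
      have "br z x \<in> H (m + i)"
        using stratum_br[OF step(2), of j x] stratum_subset_H[of "m + i" "k + j"] j i step(1) by auto
      then show ?case
        using step xg H_regular stratum_regular
        by (subst br_add_scaleR_left)
          (auto intro!: subspace_add[OF subspace_H] subspace_scale[OF subspace_H])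
    qed
    then show ?thesis
      using y xg by (simp add: br_add_scaleR_right[OF u] subspace_add[OF subspace_H]
          subspace_scale[OF subspace_H])
  qed
qed (use V_subset in blast)

lemma br_mem_H: "u \<in> H m \<Longrightarrow> Y \<in> g \<Longrightarrow> br u Y \<in> H m"
  using br_H[of u m Y 1] H_antimono[of m "m + 1"] G_1 by auto

text \<open>In positive degree this is the Jacobi identity of \<open>g\<close>; in degree at most 0
  it is the derivation rule that defines the stratum, with its two brackets rewritten through
  \<open>br\<close>.\<close>

lemma stratum_br_Jacobi:
  assumes "u \<in> prol_stratum g b V s k" "A \<in> g" "Y \<in> g"
  shows "br (br u A) Y = br (br u Y) A + br u (b A Y)"
proof (cases "1 \<le> k")
  case True
  with assms(1) obtain B where "u = emb B" "B \<in> V k"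
    by (rule stratum_posE)
  then show ?thesis
    using Jacobi[of B A Y] assms V_subset emb_add_scaleR[of _ 1]
    by (auto simp: br_def subset_iff)
next
  case False
  then have "k \<le> 0"
    by simp
  with assms(1) obtain \<phi> where \<phi>: "u = Tk 0 \<phi>"
    "\<And>A Y. A \<in> g \<Longrightarrow> Y \<in> g \<Longrightarrow>
      \<phi> (b A Y) = prol_bracket b (\<phi> A) (emb Y) + prol_bracket b (emb A) (\<phi> Y)"
    by (rule stratum_nonposE) blast
  have "\<phi> Z \<in> regular" for Z
    using mpart_regular[OF stratum_regular[OF assms(1)]] \<phi>(1) by simp
  then show ?thesis
    using assms \<phi> bracket_mem[of A Y]
    by (simp add: br_def[of "Tk 0 \<phi>"] b_zero prol_bracket_emb_right prol_bracket_emb_left)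
qed

lemma br_Jacobi:
  assumes "u \<in> H m" "A \<in> g" "Y \<in> g"
  shows "br (br u A) Y = br (br u Y) A + br u (b A Y)"
  using assms(1)
proof (induction rule: H_induct)
  case zero
  then show ?case
    using assms bracket_mem by (simp add: br_0_left)
next
  case (step k c x y)
  have xy: "x \<in> H m" "x \<in> regular" "y \<in> regular"
    using step stratum_subset_H H_regular stratum_regular by blast+
  have "br x Z \<in> regular" "br y Z \<in> regular" if "Z \<in> g" for Z
    using that xy step br_mem_H H_regular by blast+
  then show ?case
    using assms xy step(4) bracket_mem stratum_br_Jacobi[OF step(2), of A Y]
    by (simp add: br_add_scaleR_left algebra_simps)
qed

end

section \<open>Exponentials on the prolongation\<close>

lemma funpow_add_scaleR:
  fixes D :: "'a::real_vector \<Rightarrow> 'a"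
  assumes mem: "\<And>u. u \<in> S \<Longrightarrow> D u \<in> S"
    and D: "\<And>u w c. u \<in> S \<Longrightarrow> w \<in> S \<Longrightarrow> D (u + c *\<^sub>R w) = D u + c *\<^sub>R D w"
    and "u \<in> S" "w \<in> S"
  shows "(D ^^ j) (u + c *\<^sub>R w) = (D ^^ j) u + c *\<^sub>R (D ^^ j) w"
  using assms(3,4) by (induction j) (simp_all add: D funpow_mem[of S D, OF mem])

lemma lexp_add_scaleR:
  fixes D :: "'a::real_vector \<Rightarrow> 'a"
  assumes mem: "\<And>u. u \<in> S \<Longrightarrow> D u \<in> S"
    and D: "\<And>u w c. u \<in> S \<Longrightarrow> w \<in> S \<Longrightarrow> D (u + c *\<^sub>R w) = D u + c *\<^sub>R D w"
    and "u \<in> S" "w \<in> S"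
  shows "lexp N D t (u + c *\<^sub>R w) = lexp N D t u + c *\<^sub>R lexp N D t w"
  using assms
  by (simp add: lexp_def funpow_add_scaleR[of S D] scaleR_add_right sum.distrib scaleR_sum_right
      mult.commute)

context stratified_algebra
begin

section \<open>Right brackets as nilpotent operators\<close>

lemma br_add_scaleR_H:
  "u \<in> H m \<Longrightarrow> w \<in> H m \<Longrightarrow> Y \<in> g \<Longrightarrow> br (u + c *\<^sub>R w) Y = br u Y + c *\<^sub>R br w Y"
  using H_regular by (intro br_add_scaleR_left) auto

lemma funpow_br_H:
  "u \<in> H m \<Longrightarrow> A \<in> g \<Longrightarrow> ((\<lambda>w. br w A) ^^ j) u \<in> H (m + int j)"
proof (induction j)
  case (Suc j)
  then show ?case
    using br_H[of "((\<lambda>w. br w A) ^^ j) u" "m + int j" A 1] G_1 by (simp add: algebra_simps)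
qed simp

lemma br_nilpotent:
  "u \<in> H m \<Longrightarrow> A \<in> g \<Longrightarrow> s < m + int j \<Longrightarrow> ((\<lambda>w. br w A) ^^ j) u = 0"
  using funpow_br_H[of u m A j] H_trivial by auto

lemma funpow_br_0: "A \<in> g \<Longrightarrow> ((\<lambda>w. br w A) ^^ j) 0 = 0"
  by (induction j) (simp_all add: br_0_left)

lemma funpow_br_mem_H: "u \<in> H m \<Longrightarrow> A \<in> g \<Longrightarrow> ((\<lambda>w. br w A) ^^ j) u \<in> H m"
  by (rule funpow_mem[of "H m" "\<lambda>w. br w A"]) (auto intro: br_mem_H)

lemma lexp_br_mem_H: "u \<in> H m \<Longrightarrow> A \<in> g \<Longrightarrow> lexp N (\<lambda>w. br w A) c u \<in> H m"
  using br_mem_H by (intro lexp_mem[OF subspace_H]) auto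

lemma br_sum:
  assumes "finite I" "\<And>i. i \<in> I \<Longrightarrow> w i \<in> H m" "Y \<in> g"
  shows "br (\<Sum>i\<in>I. c i *\<^sub>R w i) Y = (\<Sum>i\<in>I. c i *\<^sub>R br (w i) Y)"
  by (rule linear_on_subspace_sum[OF subspace_H[of m] br_add_scaleR_H]) (use assms in auto)

lemma funpow_br_sum:
  assumes "finite I" "\<And>i. i \<in> I \<Longrightarrow> w i \<in> H m" "A \<in> g"
  shows "((\<lambda>w. br w A) ^^ j) (\<Sum>i\<in>I. c i *\<^sub>R w i) = (\<Sum>i\<in>I. c i *\<^sub>R ((\<lambda>w. br w A) ^^ j) (w i))"
proof (rule linear_on_subspace_sum[OF subspace_H[of m]])
  show "((\<lambda>w. br w A) ^^ j) (u + c *\<^sub>R w) = ((\<lambda>w. br w A) ^^ j) u + c *\<^sub>R ((\<lambda>w. br w A) ^^ j) w"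
    if "u \<in> H m" "w \<in> H m" for u w c
    using that assms(3) br_mem_H br_add_scaleR_H by (intro funpow_add_scaleR[of "H m"]) auto
qed (use assms in auto)

lemma br_sum_right:
  assumes "u \<in> H m" "finite I" "\<And>i. i \<in> I \<Longrightarrow> Y i \<in> g"
  shows "br u (\<Sum>i\<in>I. c i *\<^sub>R Y i) = (\<Sum>i\<in>I. c i *\<^sub>R br u (Y i))"
  by (rule linear_on_subspace_sum[OF subspace_g br_add_scaleR_right]) (use assms in auto)

text \<open>With \<open>R_A\<close> for bracketing on the right by \<open>A\<close>,
  \<open>br_Jacobi\<close> reads \<open>R_Y R_A = R_A R_Y + R_[A,Y]\<close>. The induction uses its
  hypothesis at both \<open>Y\<close> and \<open>[A, Y]\<close> and merges the two sums by Pascal's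
  rule.\<close>

lemma br_funpow_binomial:
  assumes u: "u \<in> H m" and A: "A \<in> g" and Y: "Y \<in> g"
  shows "br (((\<lambda>w. br w A) ^^ j) u) Y =
    (\<Sum>k\<le>j. real (j choose k) *\<^sub>R ((\<lambda>w. br w A) ^^ (j - k)) (br u ((b A ^^ k) Y)))"
  using Y
proof (induction j arbitrary: Y)
  case (Suc j)
  let ?R = "\<lambda>w. br w A"
  define x where "x k = br u ((b A ^^ k) Y)" for k
  have dY: "(b A ^^ k) Y \<in> g" for k
    by (rule funpow_mem[of g "b A", OF bracket_mem[OF A] Suc.prems])
  have x: "x k \<in> H m" for k
    unfolding x_def by (intro br_mem_H u dY)
  have "br ((?R ^^ Suc j) u) Y = ?R (br ((?R ^^ j) u) Y) + br ((?R ^^ j) u) (b A Y)"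
    using br_Jacobi[OF funpow_br_mem_H[OF u A] A Suc.prems] by simp
  also have "br ((?R ^^ j) u) (b A Y) = (\<Sum>k\<le>j. real (j choose k) *\<^sub>R (?R ^^ (j - k)) (x (Suc k)))"
    using Suc.IH[OF bracket_mem[OF A Suc.prems]] by (simp add: x_def funpow_swap1)
  also have "br ((?R ^^ j) u) Y = (\<Sum>k\<le>j. real (j choose k) *\<^sub>R (?R ^^ (j - k)) (x k))"
    using Suc by (simp add: x_def)
  also have "?R \<dots> = (\<Sum>k\<le>j. real (j choose k) *\<^sub>R ?R ((?R ^^ (j - k)) (x k)))"
    by (rule br_sum[where m = m]) (use x A funpow_br_mem_H in auto)
  also have "\<dots> = (\<Sum>k\<le>Suc j. real (j choose k) *\<^sub>R (?R ^^ (Suc j - k)) (x k))"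
    by (simp add: Suc_diff_le)
  also have "\<dots> = (?R ^^ Suc j) (x 0) + (\<Sum>k\<le>j. real (j choose Suc k) *\<^sub>R (?R ^^ (j - k)) (x (Suc k)))"
    by (subst sum.atMost_Suc_shift) simp
  also have "\<dots> + (\<Sum>k\<le>j. real (j choose k) *\<^sub>R (?R ^^ (j - k)) (x (Suc k))) =
      (\<Sum>k\<le>Suc j. real (Suc j choose k) *\<^sub>R (?R ^^ (Suc j - k)) (x k))"
    by (subst sum.atMost_Suc_shift) (simp add: sum.distrib[symmetric] scaleR_add_left add.commute)
  finally show ?case
    by (simp add: x_def)
qed simp

text \<open>This is the automorphism property of exponentials of brackets. Dividing the binomial
  formula by \<open>fact j\<close> gives a sum over the triangle \<open>k + i < N\<close>, whereas
  the two exponentials on the right multiply out to a sum over the square.\<close>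

lemma br_lexp:
  assumes u: "u \<in> H m" and A: "A \<in> g" and Y: "Y \<in> g" and N: "s < m + int N"
  shows "br (lexp N (\<lambda>w. br w A) c u) Y = lexp N (\<lambda>w. br w A) c (br u (lexp N (b A) c Y))"
proof -
  let ?R = "\<lambda>w. br w A"
  define x where "x k = br u ((b A ^^ k) Y)" for k
  have dY: "(b A ^^ k) Y \<in> g" for k
    by (rule funpow_mem[of g "b A", OF bracket_mem[OF A] Y])
  have x: "x k \<in> H m" for k
    unfolding x_def by (intro br_mem_H u dY)
  define f where "f k i = (c ^ k / fact k * (c ^ i / fact i)) *\<^sub>R (?R ^^ i) (x k)" for i k
  \<comment> \<open>The square minus the triangle contributes nothing: \<open>x k\<close> has degree
    at least \<open>m + 1 + k\<close>, and \<open>i\<close> more brackets exceed degree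
    \<open>s\<close>.\<close>
  have f0: "f k i = 0" if "N \<le> k + i" for k i
  proof -
    have "x k \<in> H (m + (1 + int k))"
      unfolding x_def by (intro br_H[OF u] funpow_bracket_G A Y) simp
    then have "(?R ^^ i) (x k) = 0"
      using that N by (intro br_nilpotent A) auto
    then show ?thesis
      by (simp add: f_def)
  qed
  have "br (lexp N ?R c u) Y = (\<Sum>j<N. (c ^ j / fact j) *\<^sub>R br ((?R ^^ j) u) Y)"
    unfolding lexp_def by (rule br_sum) (use funpow_br_mem_H u A Y in auto)
  also have "\<dots> = (\<Sum>j<N. \<Sum>k\<le>j. f k (j - k))"
  proof (intro sum.cong refl)
    fix j
    have "c ^ j / fact j * real (j choose k) = c ^ k / fact k * (c ^ (j - k) / fact (j - k))"
      if "k \<le> j" for k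
      using that by (simp add: binomial_fact power_add[symmetric])
    then show "(c ^ j / fact j) *\<^sub>R br ((?R ^^ j) u) Y = (\<Sum>k\<le>j. f k (j - k))"
      by (simp add: br_funpow_binomial[OF u A Y] scaleR_sum_right f_def x_def)
  qed
  also have "\<dots> = (\<Sum>(k, i)\<in>{(k, i). k + i < N}. f k i)"
    by (rule sum.triangle_reindex[symmetric])
  also have "\<dots> = (\<Sum>(k, i)\<in>{..<N} \<times> {..<N}. f k i)"
    by (rule sum.mono_neutral_left) (auto intro!: f0)
  also have "\<dots> = (\<Sum>i<N. \<Sum>k<N. f k i)"
    by (subst sum.swap) (simp add: sum.cartesian_product)
  also have "\<dots> = (\<Sum>i<N. (c ^ i / fact i) *\<^sub>R (?R ^^ i) (br u (lexp N (b A) c Y)))"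
  proof (intro sum.cong refl)
    fix i
    have "br u (lexp N (b A) c Y) = (\<Sum>k<N. (c ^ k / fact k) *\<^sub>R x k)"
      unfolding lexp_def x_def by (rule br_sum_right) (use u dY in auto)
    then have "(?R ^^ i) (br u (lexp N (b A) c Y)) = (\<Sum>k<N. (c ^ k / fact k) *\<^sub>R (?R ^^ i) (x k))"
      using funpow_br_sum[of "{..<N}" x m A i] x A by simp
    then show "(\<Sum>k<N. f k i) = (c ^ i / fact i) *\<^sub>R (?R ^^ i) (br u (lexp N (b A) c Y))"
      by (simp add: f_def scaleR_sum_right mult.commute)
  qed
  finally show ?thesis
    by (simp add: lexp_def)
qed

text \<open>\<open>br w A\<close> is minus \<open>ad A\<close> applied to \<open>w\<close>, so the
  time \<open>- a l\<close> yields \<open>e^{a\<^sub>l ad X\<^sub>l}\<close>. The first list element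
  acts first: this is the adjoint action of the product of flows on the prolongation.\<close>

definition Ad :: "nat \<Rightarrow> (int \<Rightarrow> 'a) \<Rightarrow> (int \<Rightarrow> real) \<Rightarrow> int list \<Rightarrow> 'a tk \<Rightarrow> 'a tk" where
  "Ad N X a = fold (\<lambda>l. lexp N (\<lambda>w. br w (X l)) (- a l))"

lemma Ad_simps: "Ad N X a [] u = u"
  "Ad N X a (l # ls) u = Ad N X a ls (lexp N (\<lambda>w. br w (X l)) (- a l) u)"
  "Ad N X a (ls @ ls') u = Ad N X a ls' (Ad N X a ls u)"
  by (simp_all add: Ad_def)

lemma Ad_mem: "X ` set ls \<subseteq> g \<Longrightarrow> u \<in> H m \<Longrightarrow> Ad N X a ls u \<in> H m"
  by (induction ls arbitrary: u) (auto simp: Ad_simps lexp_br_mem_H)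

lemma Ad_add_scaleR:
  "X ` set ls \<subseteq> g \<Longrightarrow> u \<in> H m \<Longrightarrow> w \<in> H m \<Longrightarrow>
    Ad N X a ls (u + c *\<^sub>R w) = Ad N X a ls u + c *\<^sub>R Ad N X a ls w"
proof (induction ls arbitrary: u w)
  case (Cons l ls)
  then have l: "X l \<in> g"
    by simp
  have "lexp N (\<lambda>w. br w (X l)) (- a l) (u + c *\<^sub>R w) =
      lexp N (\<lambda>w. br w (X l)) (- a l) u + c *\<^sub>R lexp N (\<lambda>w. br w (X l)) (- a l) w"
    by (rule lexp_add_scaleR[of "H m"]) (use br_mem_H br_add_scaleR_H l Cons.prems in auto)
  then show ?case
    using Cons l by (simp add: Ad_simps lexp_br_mem_H)
qed (simp add: Ad_simps)

lemma Ad_sum: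
  assumes "X ` set ls \<subseteq> g" "finite I" "\<And>i. i \<in> I \<Longrightarrow> w i \<in> H m"
  shows "Ad N X a ls (\<Sum>i\<in>I. c i *\<^sub>R w i) = (\<Sum>i\<in>I. c i *\<^sub>R Ad N X a ls (w i))"
  by (rule linear_on_subspace_sum[OF subspace_H[of m] Ad_add_scaleR]) (use assms in auto)

text \<open>In group terms \<open>[Ad(q) u, Y] = Ad(q) [u, Ad(q^{-1}) Y]\<close>:
  \<open>br_lexp\<close> is applied factor by factor, starting with the last list element, which is
  outermost in \<open>Ad\<close>.\<close>

lemma br_Ad:
  assumes "X ` set ls \<subseteq> g" "u \<in> H m" "Y \<in> g" "s < m + int N"
  shows "br (Ad N X a ls u) Y =
    Ad N X a ls (br u (foldr (\<lambda>l. lexp N (b (X l)) (- a l)) ls Y))"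
  using assms
proof (induction ls arbitrary: Y rule: rev_induct)
  case (snoc l ls)
  have "br (Ad N X a (ls @ [l]) u) Y =
      lexp N (\<lambda>w. br w (X l)) (- a l) (br (Ad N X a ls u) (lexp N (b (X l)) (- a l) Y))"
    using snoc.prems by (simp add: Ad_simps) (intro br_lexp Ad_mem; auto)
  also have "br (Ad N X a ls u) (lexp N (b (X l)) (- a l) Y) =
      Ad N X a ls (br u (foldr (\<lambda>l. lexp N (b (X l)) (- a l)) ls (lexp N (b (X l)) (- a l) Y)))"
    using snoc.prems bracket_mem by (intro snoc.IH lexp_mem[OF subspace_g]) auto
  finally show ?case
    by (simp add: Ad_simps)
qed (simp add: Ad_simps)

section \<open>Expansion of the exponentials in monomials\<close>

lemma fold_funpow_br_mem:
  "X ` set ls \<subseteq> g \<Longrightarrow> u \<in> H m \<Longrightarrow> fold (\<lambda>l. (\<lambda>w. br w (X l)) ^^ k l) ls u \<in> H m"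
  by (induction ls arbitrary: u) (auto simp: funpow_br_mem_H)

lemma fold_funpow_br_0:
  "X ` set ls \<subseteq> g \<Longrightarrow> fold (\<lambda>l. (\<lambda>w. br w (X l)) ^^ k l) ls 0 = 0"
  by (induction ls) (auto simp: funpow_br_0)

lemma fold_funpow_br_nilpotent:
  assumes "X ` set ls \<subseteq> g" "u \<in> H m" "l \<in> set ls" "s < m + int (k l)"
  shows "fold (\<lambda>l. (\<lambda>w. br w (X l)) ^^ k l) ls u = 0"
  using assms
proof (induction ls arbitrary: u)
  case (Cons l' ls)
  show ?case
  proof (cases "l' = l")
    case True
    then show ?thesis
      using Cons.prems by (simp add: br_nilpotent[of u m] fold_funpow_br_0)
  next
    case False
    then show ?thesis
      using Cons by (simp add: funpow_br_mem_H)
  qed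
qed simp

text \<open>Multiplying out the truncated exponentials, a term is a choice of an exponent below
  \<open>N\<close> for each coordinate; each new factor extends the multi-index by one
  entry.\<close>

lemma Ad_expansion:
  fixes coord :: "int \<Rightarrow> 'n"
  assumes "X ` set ls \<subseteq> g" "u \<in> H m" "distinct (map coord ls)"
  shows "Ad N X (\<lambda>l. x (coord l)) ls u =
    (\<Sum>\<alpha>\<in>PiE (coord ` set ls) (\<lambda>_. {..<N}).
      (\<Prod>c\<in>coord ` set ls. (- x c) ^ \<alpha> c / fact (\<alpha> c)) *\<^sub>R
      fold (\<lambda>l. (\<lambda>w. br w (X l)) ^^ \<alpha> (coord l)) ls u)"
  using assms
proof (induction ls rule: rev_induct)
  case (snoc l ls)
  let ?S = "coord ` set ls" and ?R = "\<lambda>w. br w (X l)"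
  let ?P = "PiE ?S (\<lambda>_. {..<N})"
  let ?M = "\<lambda>\<alpha>. \<Prod>c\<in>?S. (- x c) ^ \<alpha> c / fact (\<alpha> c)"
  let ?F = "\<lambda>\<alpha>. fold (\<lambda>l. (\<lambda>w. br w (X l)) ^^ \<alpha> (coord l)) ls u"
  let ?c = "\<lambda>k. (- x (coord l)) ^ k / fact k"
  have l: "coord l \<notin> ?S" "X l \<in> g"
    using snoc.prems by auto
  have fin: "finite ?P"
    by (intro finite_PiE) auto
  have "Ad N X (\<lambda>l. x (coord l)) (ls @ [l]) u = lexp N ?R (- x (coord l)) (\<Sum>\<alpha>\<in>?P. ?M \<alpha> *\<^sub>R ?F \<alpha>)"
    using snoc by (simp add: Ad_simps)
  also have "\<dots> = (\<Sum>k<N. ?c k *\<^sub>R (\<Sum>\<alpha>\<in>?P. ?M \<alpha> *\<^sub>R (?R ^^ k) (?F \<alpha>)))"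
    unfolding lexp_def
    by (intro sum.cong refl arg_cong[where f = "\<lambda>w. _ *\<^sub>R w"] funpow_br_sum[OF fin] l fold_funpow_br_mem)
      (use snoc.prems in auto)
  also have "\<dots> = (\<Sum>(k, \<alpha>)\<in>{..<N} \<times> ?P. (?c k * ?M \<alpha>) *\<^sub>R (?R ^^ k) (?F \<alpha>))"
    by (simp add: scaleR_sum_right sum.cartesian_product)
  \<comment> \<open>A pair \<open>(k, \<alpha>)\<close> becomes \<open>\<alpha>\<close> with value
    \<open>k\<close> at the new coordinate; this coordinate is not in \<open>?S\<close>, so the
    product and the fold over the earlier factors are unchanged (\<open>M\<close>,
    \<open>F\<close>).\<close>
  also have "\<dots> = (\<Sum>\<beta>\<in>(\<lambda>(k, \<alpha>). \<alpha>(coord l := k)) ` ({..<N} \<times> ?P).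
      (\<Prod>c\<in>insert (coord l) ?S. (- x c) ^ \<beta> c / fact (\<beta> c)) *\<^sub>R
      fold (\<lambda>l. (\<lambda>w. br w (X l)) ^^ \<beta> (coord l)) (ls @ [l]) u)"
  proof (subst sum.reindex)
    show "inj_on (\<lambda>(k, \<alpha>). \<alpha>(coord l := k)) ({..<N} \<times> ?P)"
      using inj_combinator[OF l(1), of "\<lambda>_. {..<N}"] by simp
    have M: "(\<Prod>c\<in>?S. (- x c) ^ (\<alpha>(coord l := k)) c / fact ((\<alpha>(coord l := k)) c)) = ?M \<alpha>" for k \<alpha>
      using l(1) by (intro prod.cong refl) (metis fun_upd_apply)
    have F: "fold (\<lambda>l'. (\<lambda>w. br w (X l')) ^^ (\<alpha>(coord l := k)) (coord l')) ls u = ?F \<alpha>" for k \<alpha>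
      using l(1) by (intro fold_cong refl) (metis fun_upd_apply image_eqI)
    show "(\<Sum>(k, \<alpha>)\<in>{..<N} \<times> ?P. (?c k * ?M \<alpha>) *\<^sub>R (?R ^^ k) (?F \<alpha>)) =
      (\<Sum>p\<in>{..<N} \<times> ?P. ((\<lambda>\<beta>. (\<Prod>c\<in>insert (coord l) ?S. (- x c) ^ \<beta> c / fact (\<beta> c)) *\<^sub>R
        fold (\<lambda>l. (\<lambda>w. br w (X l)) ^^ \<beta> (coord l)) (ls @ [l]) u) \<circ> (\<lambda>(k, \<alpha>). \<alpha>(coord l := k))) p)"
      by (intro sum.cong refl) (simp only: split_paired_all o_apply split_conv prod.insert[OF _ l(1)] finite_imageI
          finite_set fold_append fold_simps M F fun_upd_same)
  qed
  finally show ?case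
    by (simp add: PiE_insert_eq)
qed (simp add: Ad_simps)

end

section \<open>The derivative of extremal polynomials\<close>

text \<open>Differentiation shifts the index of \<open>q\<close>; the truncation leaves one boundary
  term, to be removed by nilpotency.\<close>

lemma sum_power_over_fact_derivative:
  "((\<lambda>t. \<Sum>k<Suc M. (- t) ^ k / fact k * q k) has_real_derivative
    (- t) ^ M / fact M * q (Suc M) - (\<Sum>k<Suc M. (- t) ^ k / fact k * q (Suc k))) (at t)"
proof (induction M)
  case (Suc M)
  have "((\<lambda>t. (- t) ^ Suc M / fact (Suc M) * q (Suc M)) has_real_derivative
      - ((- t) ^ M / fact M) * q (Suc M)) (at t)"
    by (rule DERIV_cmult_right)
      (use power_over_fact_derivative in \<open>simp add: has_real_derivative_iff_has_vector_derivative\<close>)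
  from DERIV_add[OF Suc this] show ?case
    by (simp del: fact_Suc power_Suc)
qed simp

context stratified_algebra
begin

lemma
  fixes lam :: "'a tk \<Rightarrow> real"
  assumes lam: "\<And>u w c. u \<in> H m \<Longrightarrow> w \<in> H m \<Longrightarrow> lam (u + c *\<^sub>R w) = lam u + c * lam w"
    and X: "X ` set ls \<subseteq> g"
  shows lam_Ad_sum: "finite I \<Longrightarrow> (\<And>i. i \<in> I \<Longrightarrow> w i \<in> H m) \<Longrightarrow>
      lam (Ad N X a ls (\<Sum>i\<in>I. c i *\<^sub>R w i)) = (\<Sum>i\<in>I. c i * lam (Ad N X a ls (w i)))"
    and lam_Ad_0: "lam (Ad N X a ls 0) = 0"
proof -
  show sum: "lam (Ad N X a ls (\<Sum>i\<in>I. c i *\<^sub>R w i)) = (\<Sum>i\<in>I. c i * lam (Ad N X a ls (w i)))"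
    if "finite I" "\<And>i. i \<in> I \<Longrightarrow> w i \<in> H m" for I :: "'i set" and w c
  proof -
    have "lam (\<Sum>i\<in>I. c i *\<^sub>R Ad N X a ls (w i)) = (\<Sum>i\<in>I. c i *\<^sub>R lam (Ad N X a ls (w i)))"
      by (rule linear_on_subspace_sum[OF subspace_H[of m]]) (use lam that Ad_mem[OF X] in auto)
    then show ?thesis
      using Ad_sum[OF X that] by simp
  qed
  show "lam (Ad N X a ls 0) = 0"
  proof -
    have "Ad N X a ls 0 = 0"
      using Ad_sum[OF X, of "{}" "\<lambda>_. 0"] by simp
    moreover have "lam (0 + 1 *\<^sub>R 0) = lam 0 + 1 * lam 0"
      using subspace_0[OF subspace_H] by (intro lam)
    ultimately show ?thesis
      by simp
  qed
qed

text \<open>Only the \<open>l\<close>-th factor depends on \<open>t\<close>. Its derivative brings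
  down a bracket with \<open>X l\<close>, with a minus sign, right after the factors of
  \<open>ls\<close>; \<open>br_Ad\<close> carries this bracket through them to \<open>u\<close>,
  turning \<open>X l\<close> into \<open>Z\<^sub>l\<close>.\<close>

lemma Ad_partial_derivative:
  fixes lam :: "'a tk \<Rightarrow> real" and coord :: "int \<Rightarrow> 'n::finite" and x :: "real ^ 'n"
  assumes lam: "\<And>u w c. u \<in> H m \<Longrightarrow> w \<in> H m \<Longrightarrow> lam (u + c *\<^sub>R w) = lam u + c * lam w"
    and X: "X ` set (ls @ l # ls') \<subseteq> g" and dist: "distinct (map coord (ls @ l # ls'))"
    and u: "u \<in> H m" and N: "0 < N" "s < m + int N"
  shows "((\<lambda>t. lam (Ad N X (\<lambda>k. (x + t *\<^sub>R axis (coord l) 1) $ coord k) (ls @ l # ls') u)) has_real_derivative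
    - lam (Ad N X (\<lambda>k. x $ coord k) (ls @ l # ls')
        (br u (foldr (\<lambda>k. lexp N (b (X k)) (- (x $ coord k))) ls (X l))))) (at 0)"
proof -
  define a where "a k = x $ coord k" for k
  define y where "y t k = (x + t *\<^sub>R axis (coord l) 1) $ coord k" for t k
  let ?R = "\<lambda>w. br w (X l)"
  define w where "w = Ad N X a ls u"
  define q where "q k = lam (Ad N X a ls' ((?R ^^ k) w))" for k
  have l: "X l \<in> g" and ls: "X ` set ls \<subseteq> g" and ls': "X ` set ls' \<subseteq> g"
    using X by auto
  have w: "w \<in> H m"
    unfolding w_def by (rule Ad_mem[OF ls u])
  have y: "y t k = a k" if "k \<in> set ls \<union> set ls'" for t k
  proof -
    have "coord k \<noteq> coord l"
      using dist that by (auto simp: image_iff)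
    then show ?thesis
      by (simp add: y_def a_def axis_def)
  qed
  have Ad_y: "Ad N X (y t) ls = Ad N X a ls" "Ad N X (y t) ls' = Ad N X a ls'" for t
    unfolding Ad_def using y by (intro ext fold_cong; simp)+
  have lam_lexp: "lam (Ad N X a ls' (lexp N ?R c z)) =
      (\<Sum>k<N. c ^ k / fact k * lam (Ad N X a ls' ((?R ^^ k) z)))" if "z \<in> H m" for c z
    unfolding lexp_def by (rule lam_Ad_sum[OF lam ls']) (use that l funpow_br_mem_H in auto)
  have "lam (Ad N X (y t) (ls @ l # ls') u) = (\<Sum>k<N. (- (a l + t)) ^ k / fact k * q k)" for t
    using lam_lexp[OF w] unfolding Ad_simps Ad_y w_def[symmetric] q_def
    by (simp add: y_def a_def axis_def)
  moreover have "((\<lambda>t. \<Sum>k<N. (- (a l + t)) ^ k / fact k * q k) has_real_derivative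
     - (\<Sum>k<N. (- a l) ^ k / fact k * q (Suc k))) (at 0)"
  proof -
    obtain M where M: "N = Suc M"
      using N(1) gr0_implies_Suc by auto
    \<comment> \<open>The boundary term: \<open>N = Suc M\<close> brackets with \<open>X l\<close>
      annihilate \<open>H m\<close>.\<close>
    have "q (Suc M) = 0"
      using br_nilpotent[OF w l N(2)] lam_Ad_0[OF lam ls'] by (simp only: q_def M)
    then have "((\<lambda>t. \<Sum>k<N. (- t) ^ k / fact k * q k) has_real_derivative
        - (\<Sum>k<N. (- a l) ^ k / fact k * q (Suc k))) (at (0 + a l))"
      using sum_power_over_fact_derivative[where M = M and q = q and t = "a l"] unfolding M by (simp only: add_0_left) simp
    then show ?thesis
      unfolding DERIV_shift by (simp only: add.commute)
  qed
  moreover have "(\<Sum>k<N. (- a l) ^ k / fact k * q (Suc k)) =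
      lam (Ad N X a (ls @ l # ls') (br u (foldr (\<lambda>k. lexp N (b (X k)) (- a k)) ls (X l))))"
  proof -
    have "?R w = Ad N X a ls (br u (foldr (\<lambda>k. lexp N (b (X k)) (- a k)) ls (X l)))"
      unfolding w_def by (rule br_Ad[OF ls u l N(2)])
    moreover have "q (Suc k) = lam (Ad N X a ls' ((?R ^^ k) (?R w)))" for k
      by (simp only: q_def funpow_Suc_right o_apply)
    ultimately show ?thesis
      using lam_lexp[OF br_mem_H[OF w l], of "- a l"] by (simp only: Ad_simps)
  qed
  ultimately show ?thesis
    by (simp add: y_def[abs_def] a_def[abs_def])
qed

lemma lam_Ad_expansion:
  fixes lam :: "'a tk \<Rightarrow> real" and coord :: "int \<Rightarrow> 'n::finite"
  assumes lam: "\<And>u w c. u \<in> H m \<Longrightarrow> w \<in> H m \<Longrightarrow> lam (u + c *\<^sub>R w) = lam u + c * lam w"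
    and X: "X ` set ls \<subseteq> g" and u: "u \<in> H m"
    and dist: "distinct (map coord ls)" and surj: "coord ` set ls = UNIV"
  shows "lam (Ad N X (\<lambda>l. x $ coord l) ls u) = (\<Sum>\<alpha>\<in>PiE UNIV (\<lambda>_. {..<N}).
    (\<Prod>c\<in>UNIV. (- x $ c) ^ \<alpha> c / fact (\<alpha> c)) *
      lam (fold (\<lambda>l. (\<lambda>w. br w (X l)) ^^ \<alpha> (coord l)) ls u))"
proof -
  have "Ad N X (\<lambda>l. x $ coord l) ls u = (\<Sum>\<alpha>\<in>PiE UNIV (\<lambda>_. {..<N}).
      (\<Prod>c\<in>UNIV. (- x $ c) ^ \<alpha> c / fact (\<alpha> c)) *\<^sub>R
      fold (\<lambda>l. (\<lambda>w. br w (X l)) ^^ \<alpha> (coord l)) ls u)"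
    using Ad_expansion[OF X u dist, of N "($) x"] by (simp add: surj)
  also have "lam \<dots> = (\<Sum>\<alpha>\<in>PiE UNIV (\<lambda>_. {..<N}).
      (\<Prod>c\<in>UNIV. (- x $ c) ^ \<alpha> c / fact (\<alpha> c)) *\<^sub>R
      lam (fold (\<lambda>l. (\<lambda>w. br w (X l)) ^^ \<alpha> (coord l)) ls u))"
    by (rule linear_on_subspace_sum[OF subspace_H[of m]])
      (use lam fold_funpow_br_mem[OF X u] in \<open>auto intro!: finite_PiE\<close>)
  finally show ?thesis
    by simp
qed

text \<open>The expansion is a polynomial in the coordinates. Total differentiability allows partial
  derivatives to be combined into the derivative along a vector field.\<close>

lemma lam_Ad_differentiable:
  fixes lam :: "'a tk \<Rightarrow> real" and coord :: "int \<Rightarrow> 'n::finite"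
  assumes lam: "\<And>u w c. u \<in> H m \<Longrightarrow> w \<in> H m \<Longrightarrow> lam (u + c *\<^sub>R w) = lam u + c * lam w"
    and X: "X ` set ls \<subseteq> g" and u: "u \<in> H m"
    and dist: "distinct (map coord ls)" and surj: "coord ` set ls = UNIV"
  shows "(\<lambda>x. lam (Ad N X (\<lambda>l. x $ coord l) ls u)) differentiable (at x)"
proof -
  have prod: "(\<lambda>x::real^'n. \<Prod>c\<in>A. (- x $ c) ^ \<alpha> c / fact (\<alpha> c)) differentiable (at x)"
    if "finite A" for A \<alpha>
    using that
  proof (induction A)
    case (insert c A)
    have "(\<lambda>x::real^'n. x $ c) differentiable (at x)"
      by (rule bounded_linear_imp_differentiable[OF bounded_linear_vec_nth])
    then have c: "(\<lambda>x::real^'n. (- x $ c) ^ \<alpha> c * (1 / fact (\<alpha> c))) differentiable (at x)"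
      by (intro differentiable_mult differentiable_power differentiable_minus) auto
    show ?case
      using differentiable_mult[OF c insert.IH] insert.hyps by simp
  qed simp
  have "(\<lambda>x. lam (Ad N X (\<lambda>l. x $ coord l) ls u)) = (\<lambda>x. \<Sum>\<alpha>\<in>PiE UNIV (\<lambda>_. {..<N}).
      (\<Prod>c\<in>UNIV. (- x $ c) ^ \<alpha> c / fact (\<alpha> c)) *
        lam (fold (\<lambda>l. (\<lambda>w. br w (X l)) ^^ \<alpha> (coord l)) ls u))"
    by (intro ext lam_Ad_expansion[OF lam X u dist surj])
  then show ?thesis
    by (simp only:) (intro differentiable_sum finite_PiE ballI differentiable_mult prod; simp)
qed

lemma prol_bracket_fold_eq:
  assumes "X ` set ls \<subseteq> g" "u \<in> H m" "\<And>l. l \<in> set ls \<Longrightarrow> E l = emb (X l)"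
  shows "fold (\<lambda>l. (\<lambda>w. prol_bracket b w (E l)) ^^ k l) ls u = fold (\<lambda>l. (\<lambda>w. br w (X l)) ^^ k l) ls u"
  using assms
proof (induction ls arbitrary: u)
  case (Cons l ls)
  have "((\<lambda>w. prol_bracket b w (E l)) ^^ j) u = ((\<lambda>w. br w (X l)) ^^ j) u" for j
  proof (induction j)
    case (Suc j)
    have "((\<lambda>w. br w (X l)) ^^ j) u \<in> regular"
      using Cons.prems funpow_br_mem_H[of u m] H_regular[of m] by auto
    then show ?case
      using Suc Cons.prems by (simp add: prol_bracket_emb_right)
  qed simp
  then show ?case
    using Cons by (simp add: funpow_br_mem_H)
qed simp

end

text \<open>The functional sending the \<open>k\<close>-th basis element to
  \<open>v\<^sub>k\<close>, with \<open>v\<^sub>k = 0\<close> for \<open>k \<le> 0\<close>; for an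
  independent family it is linear on the span, and off the span it is 0.\<close>

definition coeff_functional :: "(int \<Rightarrow> 'n) \<Rightarrow> int set \<Rightarrow> (int \<Rightarrow> 'a::real_vector tk) \<Rightarrow> real ^ 'n::finite \<Rightarrow> 'a tk \<Rightarrow> real"
  where "coeff_functional coord J E v u = Sum_any (\<lambda>k. tk_coeff J E u k * extend_vec coord v k)"

lemma coeff_functional_add_scaleR:
  assumes "independent (E ` J)" "u \<in> span (E ` J)" "w \<in> span (E ` J)"
  shows "coeff_functional coord J E v (u + c *\<^sub>R w) =
    coeff_functional coord J E v u + c * coeff_functional coord J E (v :: real ^ 'n::finite) w"
proof -
  \<comment> \<open>\<open>extend_vec\<close> is supported in \<open>{1..int CARD('n)}\<close>, so
    the sum is finite even for infinite \<open>J\<close>.\<close>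
  have sum: "coeff_functional coord J E v z = (\<Sum>k\<in>{1..int CARD('n)}. tk_coeff J E z k * extend_vec coord v k)" for z
    unfolding coeff_functional_def
    by (rule Sum_any.expand_superset) (auto simp: extend_vec_def)
  have "tk_coeff J E (u + c *\<^sub>R w) k = tk_coeff J E u k + c * tk_coeff J E w k" for k
    using assms by (simp add: tk_coeff_def representation_add representation_scale span_scale)
  then show ?thesis
    by (simp add: sum distrib_right sum.distrib sum_distrib_left mult.assoc)
qed

lemma representation_expansion:
  assumes E: "inj_on E J" "independent (E ` J)" and u: "u \<in> span (E ` J)"
  defines "K \<equiv> {k \<in> J. representation (E ` J) u (E k) \<noteq> 0}"
  shows "finite K" "u = (\<Sum>k\<in>K. tk_coeff J E u k *\<^sub>R E k)"
proof -
  have img: "E ` K = {b. representation (E ` J) u b \<noteq> 0}"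
    using representation_ne_zero[of "E ` J" u] by (auto simp: K_def)
  have inj: "inj_on E K"
    using E(1) by (rule inj_on_subset) (auto simp: K_def)
  show "finite K"
    using finite_representation[of "E ` J" u] img finite_imageD[OF _ inj] by simp
  have "u = (\<Sum>b\<in>E ` K. representation (E ` J) u b *\<^sub>R b)"
    using sum_nonzero_representation_eq[OF E(2) u] by (simp add: img)
  also have "\<dots> = (\<Sum>k\<in>K. tk_coeff J E u k *\<^sub>R E k)"
    by (simp add: sum.reindex[OF inj] tk_coeff_def) (auto intro!: sum.cong simp: K_def)
  finally show "u = (\<Sum>k\<in>K. tk_coeff J E u k *\<^sub>R E k)" .
qed

section \<open>The derivative of an extremal polynomial along a basis field\<close>

theorem theorem1p1:
  fixes mul :: "real ^ 'n::finite \<Rightarrow> real ^ 'n \<Rightarrow> real ^ 'n"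
    and e :: "real ^ 'n"
    and iv :: "real ^ 'n \<Rightarrow> real ^ 'n"
    and V :: "int \<Rightarrow> 'n vfield set"
    and s :: int
    and coord :: "int \<Rightarrow> 'n"
    and X :: "int \<Rightarrow> 'n vfield"
    and d :: "int \<Rightarrow> int"
    and J :: "int set"
    and E :: "int \<Rightarrow> 'n vfield tk"
    and v x :: "real ^ 'n"
    and i j :: int
  assumes "lie_group_on mul e iv"
    and "stratification (left_inv_fields mul) vf_bracket V s"
    and "adapted_basis V (left_inv_fields mul) {1..int CARD('n)} X d"
    and "bij_betw coord {1..int CARD('n)} UNIV"
    and "second_type_coordinates mul e coord X"
    and "J = {..int CARD('n)} \<or> (\<exists>m\<le>1. J = {m..int CARD('n)})"
    and "adapted_basis (prol_stratum (left_inv_fields mul) vf_bracket V s)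
           (prol (left_inv_fields mul) vf_bracket V s) J E d"
    and "\<forall>l\<in>{1..int CARD('n)}. E l = emb (X l)"
    and "i \<in> {1..int CARD('n)}"
    and "j \<in> J"
  shows "vf_apply (X i) (extremal_poly coord J E v j) x =
    Sum_any (\<lambda>k. struct_const J E i j k * extremal_poly coord J E v k x)"
proof -
  let ?n = "int CARD('n)" and ?g = "left_inv_fields mul"
  note E_emb = assms(8) and i = assms(9) and j = assms(10)
  interpret lie_group mul e iv
    by standard (rule assms(1))
  have X: "X l \<in> ?g" if "l \<in> {1..?n}" for l
    using assms(3) that span_base[of "X l" "X ` {1..?n}"] by (auto simp: adapted_basis_def)
  have subspace: "subspace ?g"
    using assms(3) subspace_span[of "X ` {1..?n}"] by (simp add: adapted_basis_def)
  interpret stratified_algebra ?g vf_bracket V s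
    by standard (auto intro: subspace assms(2) vf_bracket_antisym vf_bracket_add_scaleR_right
        vf_bracket_Jacobi left_inv_smooth)
  have EJ: "inj_on E J" "independent (E ` J)" "span (E ` J) = prol ?g vf_bracket V s"
    and E_stratum: "\<And>k. k \<in> J \<Longrightarrow> E k \<in> prol_stratum ?g vf_bracket V s (d k)"
    using assms(7) by (auto simp: adapted_basis_def)

  define u where "u = prol_bracket vf_bracket (E i) (E j)"
  define K where "K = {k \<in> J. representation (E ` J) u (E k) \<noteq> 0}"
  have Ej_regular: "E j \<in> regular"
    using stratum_regular E_stratum[OF j] by blast
  have u_eq: "u = - br (E j) (X i)"
    unfolding u_def using E_emb i prol_bracket_emb_left[OF Ej_regular] by simp
  have u_span: "u \<in> span (E ` J)"
  proof -
    have "br (E j) (X i) \<in> H (d j)"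
      using br_mem_H stratum_subset_H[of "d j" "d j"] E_stratum[OF j] X[OF i] by blast
    then show ?thesis
      unfolding u_eq EJ(3) using H_subset_prol subspace_neg[of "prol ?g vf_bracket V s"]
      by (auto simp: prol_def)
  qed
  note finite_K = representation_expansion(1)[OF EJ(1,2) u_span, folded K_def]
    and u_expansion = representation_expansion(2)[OF EJ(1,2) u_span, folded K_def]

  \<comment> \<open>\<open>m\<close> is the lowest degree among \<open>E j\<close> and the basis
    elements occurring in \<open>u\<close>, so all of them lie in one \<open>H m\<close>.
    \<open>N\<close> is then large enough for brackets on \<open>H m\<close> as well as for those on
    \<open>g\<close>.\<close>
  define m where "m = Min (insert (d j) (d ` K))"
  define N where "N = nat (s - m) + nat s + 1"
  have N: "0 < N" "s < m + int N" "s \<le> int N"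
    by (auto simp: N_def)
  interpret exponential_coordinates mul e iv coord X N
    by standard (auto intro: assms(4,5) subspace X bracket_mem bracket_nilpotent[OF X _ N(3)])

  let ?l = "coeff_functional coord J E v"
  let ?A = "\<lambda>x. Ad N X (\<lambda>l. x $ coord l) [1..?n]"
  have lam: "?l (w + c *\<^sub>R z) = ?l w + c * ?l z" if "w \<in> H m" "z \<in> H m" for w z c
    using that H_subset_prol[of m] by (intro coeff_functional_add_scaleR EJ(2)) (auto simp: EJ(3))
  have Xg: "X ` set [1..?n] \<subseteq> ?g"
    using X by auto
  have coord_set: "coord ` set [1..?n] = UNIV"
    using assms(4) by (simp add: bij_betw_def)
  have coord_distinct: "distinct (map coord [1..?n])"
    using assms(4) by (simp add: bij_betw_def distinct_map)
  have E_H: "E k \<in> H m" if "k \<in> insert j K" for k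
  proof -
    have "m \<le> d k"
      using that finite_K unfolding m_def by (intro Min_le) auto
    moreover have "k \<in> J"
      using that j by (auto simp: K_def)
    ultimately show ?thesis
      using stratum_subset_H E_stratum by blast
  qed

  \<comment> \<open>For these indices \<open>E k\<close> lies in \<open>H m\<close>, where
    truncation at \<open>N\<close> is exact.\<close>
  have poly: "extremal_poly coord J E v k = (\<lambda>x. ?l (?A x (E k)))" if k: "k \<in> insert j K" for k
  proof
    fix x
    note u = E_H[OF k]
    let ?F = "\<lambda>\<alpha>. fold (\<lambda>l. (\<lambda>w. br w (X l)) ^^ \<alpha> (coord l)) [1..?n] (E k)"
    have iter: "iter_bracket coord E k \<alpha> = ?F \<alpha>" for \<alpha>
      unfolding iter_bracket_def by (rule prol_bracket_fold_eq[OF Xg u]) (use E_emb in auto)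
    have l_iter: "Sum_any (\<lambda>k'. gen_struct_const coord J E k \<alpha> k' * extend_vec coord v k') = ?l (?F \<alpha>)" for \<alpha>
      by (simp add: coeff_functional_def gen_struct_const_def iter)
    have l_0: "?l 0 = 0"
      using lam_Ad_0[OF lam, where ls = "[]"] by (simp add: Ad_simps)
    \<comment> \<open>The sign is distributed over the monomial, one factor -1 for each
      bracket.\<close>
    have coef: "(- 1) ^ (\<Sum>a\<in>UNIV. \<alpha> a) / (\<Prod>a\<in>UNIV. fact (\<alpha> a)) * y * (\<Prod>a\<in>UNIV. (x $ a) ^ \<alpha> a) =
        (\<Prod>a\<in>UNIV. (- x $ a) ^ \<alpha> a / fact (\<alpha> a)) * y" for \<alpha> :: "'n \<Rightarrow> nat" and y :: real
      by (simp add: power_minus[of "x $ _"] prod.distrib prod_dividef power_sum)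
    have "extremal_poly coord J E v k x =
        Sum_any (\<lambda>\<alpha>. (\<Prod>a\<in>UNIV. (- x $ a) ^ \<alpha> a / fact (\<alpha> a)) * ?l (?F \<alpha>))"
      unfolding extremal_poly_def l_iter coef ..
    \<comment> \<open>A multi-index with an entry of at least \<open>N\<close> has zero iterated
      bracket, so a finite box of multi-indices remains.\<close>
    also have "\<dots> = (\<Sum>\<alpha>\<in>PiE UNIV (\<lambda>_. {..<N}). (\<Prod>a\<in>UNIV. (- x $ a) ^ \<alpha> a / fact (\<alpha> a)) * ?l (?F \<alpha>))"
    proof (rule Sum_any.expand_superset)
      show "{\<alpha>. (\<Prod>a\<in>UNIV. (- x $ a) ^ \<alpha> a / fact (\<alpha> a)) * ?l (?F \<alpha>) \<noteq> 0} \<subseteq> PiE UNIV (\<lambda>_. {..<N})"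
      proof (rule ccontr)
        assume "\<not> ?thesis"
        then obtain \<alpha> where \<alpha>: "?l (?F \<alpha>) \<noteq> 0" "\<alpha> \<notin> PiE UNIV (\<lambda>_. {..<N})"
          by auto
        then have "\<exists>a. \<not> \<alpha> a < N"
          by (auto simp: PiE_UNIV_domain)
        then obtain a where a: "N \<le> \<alpha> a"
          by (auto simp: not_less)
        obtain l where "l \<in> set [1..?n]" "a = coord l"
          using coord_set by (metis UNIV_I imageE)
        then have "?F \<alpha> = 0"
          using a N(2) by (intro fold_funpow_br_nilpotent[OF Xg u, of l]) auto
        then show False
          using \<alpha>(1) l_0 by simp
      qed
    qed (auto intro: finite_PiE)
    also have "\<dots> = ?l (?A x (E k))"
      by (rule lam_Ad_expansion[OF lam Xg u coord_distinct coord_set, symmetric])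
    finally show "extremal_poly coord J E v k x = ?l (?A x (E k))" .
  qed

  let ?P = "\<lambda>x. ?l (?A x (E j))" and ?D = "frechet_derivative (\<lambda>x. ?l (?A x (E j))) (at x)"
  let ?Z = "\<lambda>l. Ad_inv (\<lambda>k. x $ coord k) [1..l - 1] (X l)"
  have Ej: "E j \<in> H m"
    by (rule E_H) simp
  have P': "(?P has_derivative ?D) (at x)"
    using lam_Ad_differentiable[OF lam Xg Ej coord_distinct coord_set] frechet_derivative_works
    by blast
  \<comment> \<open>The derivative along a coordinate line is computed by the chain rule and by
    \<open>Ad_partial_derivative\<close>.\<close>
  have D_axis: "?D (axis (coord l) 1) = - ?l (?A x (br (E j) (?Z l)))" if l: "l \<in> {1..?n}" for l
  proof -
    have split: "[1..?n] = [1..l - 1] @ l # [l + 1..?n]"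
      using l by (intro upto_split3) auto
    have "((\<lambda>t. x + t *\<^sub>R axis (coord l) 1) has_vector_derivative axis (coord l) 1) (at 0)"
      by (auto intro!: derivative_eq_intros)
    moreover have "(?P has_derivative ?D) (at (x + 0 *\<^sub>R axis (coord l) 1))"
      using P' by simp
    ultimately have "((\<lambda>t. ?P (x + t *\<^sub>R axis (coord l) 1)) has_vector_derivative ?D (axis (coord l) 1)) (at 0)"
      using vector_derivative_diff_chain_within[OF _ has_derivative_at_withinI] by (fastforce simp: o_def)
    moreover have "((\<lambda>t. ?P (x + t *\<^sub>R axis (coord l) 1)) has_vector_derivative
        - ?l (?A x (br (E j) (?Z l)))) (at 0)"
      using Ad_partial_derivative[OF lam, where X = X and ls = "[1..l - 1]" and l = l
          and ls' = "[l + 1..?n]" and coord = coord and u = "E j" and N = N and x = x]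
        Xg coord_distinct Ej N unfolding split[symmetric] has_real_derivative_iff_has_vector_derivative
      by blast
    ultimately show ?thesis
      by (rule vector_derivative_unique_at)
  qed
  have Z: "?Z l \<in> ?g" if "l \<in> {1..?n}" for l
    using that by (intro Ad_inv_mem X) auto
  have "vf_apply (X i) (extremal_poly coord J E v j) x = ?D (X i x)"
    unfolding vf_apply_def by (simp add: poly)
  also have "X i x = (\<Sum>c\<in>UNIV. (X i x $ c) *\<^sub>R axis c 1)"
    using basis_expansion[of "X i x"] by (simp add: scalar_mult_eq_scaleR)
  also have "\<dots> = (\<Sum>l\<in>{1..?n}. (X i x $ coord l) *\<^sub>R axis (coord l) 1)"
    by (rule sum.reindex_bij_betw[OF assms(4), symmetric])
  also have "?D \<dots> = (\<Sum>l\<in>{1..?n}. (X i x $ coord l) *\<^sub>R ?D (axis (coord l) 1))"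
    using has_derivative_linear[OF P'] by (simp add: linear_sum linear_scale)
  also have "\<dots> = - (\<Sum>l\<in>{1..?n}. (X i x $ coord l) * ?l (?A x (br (E j) (?Z l))))"
    by (simp add: D_axis sum_negf)
  also have "\<dots> = - ?l (?A x (\<Sum>l\<in>{1..?n}. (X i x $ coord l) *\<^sub>R br (E j) (?Z l)))"
    by (subst lam_Ad_sum[OF lam Xg]) (use br_mem_H[OF Ej] Z in auto)
  \<comment> \<open>The coefficients are constants, the point \<open>x\<close> being fixed;
    \<open>left_inv_expansion\<close> reassembles the fields \<open>?Z l\<close> into
    \<open>X i\<close> inside the bracket.\<close>
  also have "(\<Sum>l\<in>{1..?n}. (X i x $ coord l) *\<^sub>R br (E j) (?Z l)) = br (E j) (X i)"
    using br_sum_right[OF Ej, of "{1..?n}" ?Z "\<lambda>l. X i x $ coord l"] Z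
      left_inv_expansion[OF X[OF i], of x] by simp
  also have "- ?l (?A x (br (E j) (X i))) = ?l (?A x u)"
    using lam_Ad_sum[OF lam Xg, where I = "{()}" and w = "\<lambda>_. br (E j) (X i)" and c = "\<lambda>_. - 1"] br_mem_H[OF Ej X[OF i]]
    by (simp add: u_eq)
  also have "\<dots> = (\<Sum>k\<in>K. tk_coeff J E u k * ?l (?A x (E k)))"
    by (subst u_expansion) (rule lam_Ad_sum[OF lam Xg finite_K], use E_H in auto)
  also have "\<dots> = (\<Sum>k\<in>K. struct_const J E i j k * extremal_poly coord J E v k x)"
    by (simp add: struct_const_def u_def[symmetric] poly)
  \<comment> \<open>The structure constants vanish off \<open>K\<close>: outside \<open>J\<close> by
    \<open>tk_coeff\<close>, inside \<open>J\<close> by the choice of \<open>K\<close>.\<close>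
  also have "\<dots> = Sum_any (\<lambda>k. struct_const J E i j k * extremal_poly coord J E v k x)"
    by (rule Sum_any.expand_superset[symmetric, OF finite_K])
      (auto simp: struct_const_def u_def[symmetric] tk_coeff_def K_def split: if_splits)
  finally show ?thesis .
qed

end
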